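(* Consider the problem $\min_{x\in C}f(x)=\mathbb E[F(x,\xi)]$ with $C\subset\mathbb R^n$ a nonempty closed convex set. Let $\{x_k\}$, $\{v_k\}$ be generated, from initial values $v_1,v_2$, by the stochastic subgradient method with Nesterov acceleration $$x_{k+1}=(1+\theta)v_k-\theta v_{k-1},\qquad v_{k+1}=\Pi_C\big(x_{k+1}-\alpha_kg(x_{k+1},\xi_{k+1})\big),\qquad k\ge2,$$ where $g(x_{k+1},\xi_{k+1})\in\partial_xF(x_{k+1},\xi_{k+1})$ and the momentum parameter $\theta\in(0,1)$ is constant. Assume: (a) $F(\cdot,\xi)$ is continuous and convex for almost every $\xi\in\Xi$; (b) $g(\cdot,\xi)$ is a subgradient of $F(\cdot,\xi)$ for almost every $\xi\in\Xi$; (c) the step sizes satisfy $\alpha_k\ge0$, $\sum_{k=1}^\infty\alpha_k=\infty$, $\sum_{k=1}^\infty\alpha_k^2<\infty$; (d) the subdifferential is almost surely bounded: there is a constant $M$ such that $\sup_{x\in\mathbb R^n}\|g(x,\xi)\|\le M$ for all $g(x,\xi)\in\partial_x F(x,\xi)$, for almost every $\xi\in\Xi$. Then the sequences $\{x_k\}$ and $\{v_k\}$ both converge almost surely to the same optimal solution of the problem.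
   Context: $\xi$ is a random variable with values in $\Xi$, and $\xi_{k}$ are independent random samples distributed as $\xi$. $\Pi_C$ is the Euclidean projection onto $C$, and $\partial_xF(x,\xi)$ is the convex subdifferential of $F(\cdot,\xi)$ at $x$. The step sizes $\{\alpha_k\}$ are deterministic.
   Formalization: It is additionally assumed that the problem has an optimal solution in C (otherwise the claim fails, e.g. F(x,ξ) = −x on C = ℝ); F(x,·) is taken measurable and integrable, g jointly measurable, and v_1, v_2 deterministic. *)

theory Defs
  imports "HOL-Probability.Probability"
begin

definition subdifferential :: "('a::real_inner \<Rightarrow> real) \<Rightarrow> 'a \<Rightarrow> 'a set" where
  "subdifferential h x = {u. \<forall>y. h y \<ge> h x + u \<bullet> (y - x)}"

definition expected_objective ::
  "'w measure \<Rightarrow> ('w \<Rightarrow> 's) \<Rightarrow> ('a \<Rightarrow> 's \<Rightarrow> real) \<Rightarrow> 'a \<Rightarrow> real" where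
  "expected_objective P \<xi> F x = prob_space.expectation P (\<lambda>\<omega>. F x (\<xi> \<omega>))"

definition optimal_solution :: "('a \<Rightarrow> real) \<Rightarrow> 'a set \<Rightarrow> 'a \<Rightarrow> bool" where
  "optimal_solution f C x \<longleftrightarrow> is_arg_min f (\<lambda>y. y \<in> C) x"

(* Sample paths: x and v are sequences of points, s is a realised sequence of samples.
   The entries x 0, x 1, x 2 and v 0 play no role. *)
definition nesterov_subgradient_iterates ::
  "'a::euclidean_space set \<Rightarrow> ('a \<Rightarrow> 's \<Rightarrow> 'a) \<Rightarrow> (nat \<Rightarrow> real) \<Rightarrow> real \<Rightarrow> 'a \<Rightarrow> 'a
    \<Rightarrow> (nat \<Rightarrow> 's) \<Rightarrow> (nat \<Rightarrow> 'a) \<Rightarrow> (nat \<Rightarrow> 'a) \<Rightarrow> bool" where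
  "nesterov_subgradient_iterates C g \<alpha> \<theta> a1 a2 s x v \<longleftrightarrow>
     v 1 = a1 \<and> v 2 = a2 \<and>
     (\<forall>k\<ge>2. x (k + 1) = (1 + \<theta>) *\<^sub>R v k - \<theta> *\<^sub>R v (k - 1) \<and>
            v (k + 1) = closest_point C (x (k + 1) - \<alpha> k *\<^sub>R g (x (k + 1)) (s (k + 1))))"

end

theory Submission
  imports Defs
begin

text \<open>The steps \<open>d n = norm (v (n + 1) - v n)\<close> satisfy
  \<open>d (n + 1) \<le> \<theta> * d n + \<alpha> n * M\<close> up to the first one, so they are dominated by a deterministic
  square-summable sequence. For a minimizer \<open>z\<close>, the quantity
  \<open>(norm (v (n + 1) - z))\<^sup>2 - \<theta> * (norm (v n - z))\<^sup>2\<close> then decreases by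
  \<open>2 * \<alpha> n * (f (v (n + 1)) - f z)\<close>, up to summable errors and the martingale difference
  \<open>2 * \<alpha> n * (noise \<bullet> (x - z))\<close>. Taking expectations gives bounded second moments; by Kolmogorov's
  maximal inequality the martingale converges almost surely, and hence
  so do all distances to minimizers. As the step sizes are not summable, some cluster point is a
  minimizer, and the distance to it tends to 0.\<close>

text \<open>The Lyapunov quantity comes from the identity \<open>|(1 + \<theta>) p - \<theta> q|^2 =
  (1 + \<theta>) |p|^2 - \<theta> |q|^2 + \<theta> (1 + \<theta>) |p - q|^2\<close>, with p and q
  the last two iterates minus \<open>z\<close>: extrapolation costs only a multiple of the squared
  step, which is summable. Being a difference, the quantity can be negative; Young's inequality and
  the bounded steps keep it bounded below. Its convergence passes to the squared distances
  \<open>a n\<close>, since they satisfy \<open>a (n + 1) = \<theta> * a n + b n\<close> with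
  \<open>b n\<close> the Lyapunov quantity. The obstacle is that \<open>C\<close> may be unbounded.
  Each iterate is bounded over the sample space, but by a constant depending on n. Only a second
  moment bound uniform in n makes the variances of the martingale differences, of order
  \<open>(\<alpha> n)^2\<close>, summable.\<close>

section \<open>Contracting scalar recursions and the quadratic momentum estimate\<close>

text \<open>From some index on the errors stay below \<open>(1 - \<theta>) * (r / 2)\<close>. The
  recursion with this constant error has the fixed point \<open>r / 2\<close>, and the excess over
  it decays geometrically.\<close>

lemma contraction_perturbed_tendsto_0:
  fixes c \<epsilon> :: "nat \<Rightarrow> real"
  assumes "0 \<le> \<theta>" "\<theta> < 1" and c0: "\<And>n. 0 \<le> c n"
    and step: "\<And>n. c (Suc n) \<le> \<theta> * c n + \<epsilon> n" and "\<epsilon> \<longlonglongrightarrow> 0"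
  shows "c \<longlonglongrightarrow> 0"
proof (rule LIMSEQ_I)
  fix r :: real assume "r > 0"
  with assms have "(1 - \<theta>) * (r / 2) > 0" by simp
  then obtain N where N: "\<And>n. n \<ge> N \<Longrightarrow> norm (\<epsilon> n - 0) < (1 - \<theta>) * (r / 2)"
    using LIMSEQ_D[OF \<open>\<epsilon> \<longlonglongrightarrow> 0\<close>] by blast
  have bound: "c (N + k) \<le> \<theta> ^ k * c N + r / 2" for k
  proof (induction k)
    case 0 show ?case using \<open>r > 0\<close> by simp
  next
    case (Suc k)
    have "c (N + Suc k) \<le> \<theta> * c (N + k) + \<epsilon> (N + k)" using step[of "N + k"] by simp
    also have "\<dots> \<le> \<theta> * (\<theta> ^ k * c N + r / 2) + (1 - \<theta>) * (r / 2)"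
      using Suc N[of "N + k"] assms(1) by (intro add_mono mult_left_mono) auto
    also have "\<dots> = \<theta> ^ Suc k * c N + r / 2" by (simp add: field_simps)
    finally show ?case .
  qed
  have "(\<lambda>k. \<theta> ^ k * c N) \<longlonglongrightarrow> 0 * c N"
    using assms by (intro tendsto_mult LIMSEQ_power_zero tendsto_const) auto
  then obtain K where K: "\<And>k. k \<ge> K \<Longrightarrow> norm (\<theta> ^ k * c N) < r / 2"
    using LIMSEQ_D[of "\<lambda>k. \<theta> ^ k * c N" 0 "r / 2"] \<open>r > 0\<close> by auto
  show "\<exists>n0. \<forall>n\<ge>n0. norm (c n - 0) < r"
  proof (intro exI allI impI)
    fix n assume "n \<ge> N + K"
    then obtain k where k: "n = N + k" "k \<ge> K" by (metis add_leD1 le_Suc_ex nat_add_left_cancel_le)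
    then show "norm (c n - 0) < r" using bound[of k] K[of k] c0[of n] by auto
  qed
qed

text \<open>The deviation from the fixed point \<open>L / (1 - \<theta>)\<close> is contracted by
  \<theta>, up to the error \<open>b n - L\<close>.\<close>

lemma affine_recurrence_tendsto:
  fixes a b :: "nat \<Rightarrow> real"
  assumes \<theta>: "0 \<le> \<theta>" "\<theta> < 1" and rec: "\<And>n. a (Suc n) = \<theta> * a n + b n" and b: "b \<longlonglongrightarrow> L"
  shows "a \<longlonglongrightarrow> L / (1 - \<theta>)"
proof -
  have "(\<lambda>n. \<bar>a n - L / (1 - \<theta>)\<bar>) \<longlonglongrightarrow> 0"
  proof (rule contraction_perturbed_tendsto_0[OF \<theta>])
    show "(\<lambda>n. \<bar>b n - L\<bar>) \<longlonglongrightarrow> 0" using b by (simp add: LIM_zero_iff tendsto_rabs_zero_iff)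
    fix n
    have "a (Suc n) - L / (1 - \<theta>) = \<theta> * (a n - L / (1 - \<theta>)) + (b n - L)"
      unfolding rec using \<theta> by (simp add: field_simps)
    then have "\<bar>a (Suc n) - L / (1 - \<theta>)\<bar> \<le> \<bar>\<theta> * (a n - L / (1 - \<theta>))\<bar> + \<bar>b n - L\<bar>"
      by (metis abs_triangle_ineq)
    then show "\<bar>a (Suc n) - L / (1 - \<theta>)\<bar> \<le> \<theta> * \<bar>a n - L / (1 - \<theta>)\<bar> + \<bar>b n - L\<bar>"
      using \<theta> by (simp add: abs_mult)
  qed auto
  then show ?thesis by (simp add: tendsto_rabs_zero_iff LIM_zero_iff)
qed

text \<open>Writing the error as \<open>(1 - \<theta>) * t\<close> makes the right-hand side a
  convex combination of \<open>D n\<close> and \<open>t\<close>, so convexity of the square keeps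
  the factor \<theta>. After summation the left side absorbs \<theta> times the same sum.\<close>

lemma contraction_perturbed_square_summable:
  fixes D c :: "nat \<Rightarrow> real"
  assumes \<theta>: "0 \<le> \<theta>" "\<theta> < 1" and D0: "\<And>n. 0 \<le> D n"
    and step: "\<And>n. D (Suc n) \<le> \<theta> * D n + c n" and c: "summable (\<lambda>n. (c n)\<^sup>2)"
  shows "summable (\<lambda>n. (D n)\<^sup>2)"
proof -
  have sq: "(D (Suc n))\<^sup>2 \<le> \<theta> * (D n)\<^sup>2 + (c n)\<^sup>2 / (1 - \<theta>)" for n
  proof -
    define t where "t = c n / (1 - \<theta>)"
    have c_t: "c n = (1 - \<theta>) * t" using \<theta> by (simp add: t_def)
    have "(D (Suc n))\<^sup>2 \<le> (\<theta> * D n + (1 - \<theta>) * t)\<^sup>2"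
      using step[of n] D0[of "Suc n"] by (simp add: c_t power_mono)
    also have "\<dots> = \<theta> * (D n)\<^sup>2 + (1 - \<theta>) * t\<^sup>2 - \<theta> * (1 - \<theta>) * (D n - t)\<^sup>2"
      by (simp add: power2_eq_square algebra_simps)
    also have "\<dots> \<le> \<theta> * (D n)\<^sup>2 + (1 - \<theta>) * t\<^sup>2" using \<theta> by simp
    also have "(1 - \<theta>) * t\<^sup>2 = (c n)\<^sup>2 / (1 - \<theta>)"
      using \<theta> by (simp add: t_def power2_eq_square)
    finally show ?thesis by simp
  qed
  define S where "S = (\<Sum>n. (c n)\<^sup>2)"
  show ?thesis
  proof (rule summableI_nonneg_bounded)
    fix n
    have "(\<Sum>i<n. (D i)\<^sup>2) \<le> (\<Sum>i<Suc n. (D i)\<^sup>2)" by simp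
    also have "\<dots> = (D 0)\<^sup>2 + (\<Sum>i<n. (D (Suc i))\<^sup>2)" by (subst sum.lessThan_Suc_shift) simp
    also have "\<dots> \<le> (D 0)\<^sup>2 + (\<Sum>i<n. \<theta> * (D i)\<^sup>2 + (c i)\<^sup>2 / (1 - \<theta>))"
      by (intro add_left_mono sum_mono sq)
    also have "\<dots> = (D 0)\<^sup>2 + \<theta> * (\<Sum>i<n. (D i)\<^sup>2) + (\<Sum>i<n. (c i)\<^sup>2) / (1 - \<theta>)"
      by (simp add: sum.distrib sum_distrib_left sum_divide_distrib)
    also have "(\<Sum>i<n. (c i)\<^sup>2) / (1 - \<theta>) \<le> S / (1 - \<theta>)"
      unfolding S_def using \<theta> c by (intro divide_right_mono sum_le_suminf) auto
    finally have "(1 - \<theta>) * (\<Sum>i<n. (D i)\<^sup>2) \<le> (D 0)\<^sup>2 + S / (1 - \<theta>)"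
      by (simp add: algebra_simps)
    then show "(\<Sum>i<n. (D i)\<^sup>2) \<le> ((D 0)\<^sup>2 + S / (1 - \<theta>)) / (1 - \<theta>)"
      using \<theta> by (simp add: pos_le_divide_eq mult.commute)
  qed auto
qed

text \<open>Young's inequality with weight \<^term>\<open>(1 - \<theta>) / (2 * \<theta>)\<close>.\<close>
lemma momentum_lyapunov_ge:
  fixes p q z :: "'a::real_inner"
  assumes \<theta>: "0 < \<theta>" "\<theta> < 1" and d: "norm (q - p) \<le> d"
  shows "(norm (q - z))\<^sup>2 - \<theta> * (norm (p - z))\<^sup>2
    \<ge> (1 - \<theta>) / 2 * (norm (q - z))\<^sup>2 - \<theta> * (1 + \<theta>) / (1 - \<theta>) * d\<^sup>2"
proof -
  define A where "A = norm (q - z)"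
  have "norm (p - z) \<le> A + d"
    using norm_triangle_ineq[of "p - q" "q - z"] d by (simp add: A_def norm_minus_commute)
  then have "(norm (p - z))\<^sup>2 \<le> (A + d)\<^sup>2" by (intro power_mono) auto
  moreover have "\<theta> * (A + d)\<^sup>2 \<le> (1 + \<theta>) / 2 * A\<^sup>2 + \<theta> * (1 + \<theta>) / (1 - \<theta>) * d\<^sup>2"
  proof -
    have "(1 + \<theta>) / 2 * A\<^sup>2 + \<theta> * (1 + \<theta>) / (1 - \<theta>) * d\<^sup>2 - \<theta> * (A + d)\<^sup>2
      = ((1 - \<theta>) * A - 2 * \<theta> * d)\<^sup>2 / (2 * (1 - \<theta>))"
      using \<theta> by (simp add: field_simps power2_eq_square)
    also have "\<dots> \<ge> 0" using \<theta> by simp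
    finally show ?thesis by simp
  qed
  ultimately have "\<theta> * (norm (p - z))\<^sup>2 \<le> (1 + \<theta>) / 2 * A\<^sup>2 + \<theta> * (1 + \<theta>) / (1 - \<theta>) * d\<^sup>2"
    using \<theta> by (meson mult_left_mono less_imp_le order_trans)
  then show ?thesis by (simp add: A_def field_simps)
qed

section \<open>Convergence of a single sample path\<close>

text \<open>An Opial-type argument: the distance to every minimizer converges, some cluster point is
  a minimizer, and the distance to that one tends to 0 along a subsequence. The errors
  \<open>e\<close> may depend on the minimizer and have either sign, because they will contain
  convergent martingale series. The points \<open>u n\<close> are feasible stand-ins for
  \<open>w (Suc n)\<close>, so that \<open>f (u n) - f z\<close> is nonnegative.\<close>

lemma lyapunov_momentum_convergence:
  fixes w u :: "nat \<Rightarrow> 'a::euclidean_space" and f :: "'a \<Rightarrow> real"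
  assumes \<theta>: "0 < \<theta>" "\<theta> < 1"
    and D: "\<And>n. norm (w (Suc n) - w n) \<le> D n" "summable (\<lambda>n. (D n)\<^sup>2)"
    and C: "closed C" and u: "\<And>n. u n \<in> C" and uw: "(\<lambda>n. u n - w (Suc n)) \<longlonglongrightarrow> 0"
    and \<beta>: "\<And>n. 0 \<le> \<beta> n" "\<not> summable \<beta>"
    and f: "continuous_on C f"
    and ex: "z0 \<in> C" "\<And>y. y \<in> C \<Longrightarrow> f z0 \<le> f y"
    and lyap: "\<And>z. z \<in> C \<Longrightarrow> (\<And>y. y \<in> C \<Longrightarrow> f z \<le> f y) \<Longrightarrow>
      \<exists>e. summable e \<and> (\<forall>n. (norm (w (Suc (Suc n)) - z))\<^sup>2 - \<theta> * (norm (w (Suc n) - z))\<^sup>2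
        \<le> (norm (w (Suc n) - z))\<^sup>2 - \<theta> * (norm (w n - z))\<^sup>2 - 2 * \<beta> n * (f (u n) - f z) + e n)"
  shows "\<exists>z. z \<in> C \<and> (\<forall>y\<in>C. f z \<le> f y) \<and> w \<longlonglongrightarrow> z"
proof -
  have key: "convergent (\<lambda>n. (norm (w n - z))\<^sup>2) \<and> summable (\<lambda>n. 2 * \<beta> n * (f (u n) - f z))"
    if z: "z \<in> C" "\<And>y. y \<in> C \<Longrightarrow> f z \<le> f y" for z
  proof -
    define b where "b n = (norm (w (Suc n) - z))\<^sup>2 - \<theta> * (norm (w n - z))\<^sup>2" for n
    define p where "p n = 2 * \<beta> n * (f (u n) - f z)" for n
    have p0: "p n \<ge> 0" for n unfolding p_def using \<beta> z u by simp
    obtain e where e: "summable e" and step: "\<And>n. b (Suc n) \<le> b n - p n + e n"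
      using lyap[OF z] unfolding b_def p_def by blast
    \<comment> \<open>Subtracting the partial sums of \<open>e\<close> gives a monotone sequence,
      although \<open>e\<close> need not be absolutely summable.\<close>
    define h where "h n = b n - (\<Sum>i<n. e i)" for n
    have hp: "h (Suc n) \<le> h n - p n" for n using step[of n] by (simp add: h_def)
    have dec: "decseq h" using hp p0 by (intro decseq_SucI) (smt (verit))
    define K where "K = \<theta> * (1 + \<theta>) / (1 - \<theta>)"
    have K0: "K \<ge> 0" using \<theta> by (simp add: K_def)
    have b_ge: "b n \<ge> - K * (\<Sum>i. (D i)\<^sup>2)" for n
    proof -
      have "(D n)\<^sup>2 \<le> (\<Sum>i. (D i)\<^sup>2)"
        using sum_le_suminf[OF D(2), of "{n}"] by simp
      then have "K * (D n)\<^sup>2 \<le> K * (\<Sum>i. (D i)\<^sup>2)" using K0 by (rule mult_left_mono)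
      moreover have "b n \<ge> (1 - \<theta>) / 2 * (norm (w (Suc n) - z))\<^sup>2 - K * (D n)\<^sup>2"
        unfolding b_def K_def using momentum_lyapunov_ge[OF \<theta> D(1)] .
      moreover have "(1 - \<theta>) / 2 * (norm (w (Suc n) - z))\<^sup>2 \<ge> 0" using \<theta> by simp
      ultimately show ?thesis by linarith
    qed
    have "Bseq (\<lambda>n. \<Sum>i<n. e i)"
      using e by (simp add: summable_iff_convergent convergent_imp_Bseq)
    then obtain E where E: "\<And>n. \<bar>\<Sum>i<n. e i\<bar> \<le> E" unfolding Bseq_def by auto
    have h_ge: "h n \<ge> - K * (\<Sum>i. (D i)\<^sup>2) - E" for n
      using b_ge[of n] E[of n] unfolding h_def by linarith
    obtain L where L: "h \<longlonglongrightarrow> L" using decseq_convergent[OF dec, of "- K * (\<Sum>i. (D i)\<^sup>2) - E"] h_ge by blast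
    have "(\<lambda>n. h n + (\<Sum>i<n. e i)) \<longlonglongrightarrow> L + suminf e"
      using L summable_LIMSEQ[OF e] by (rule tendsto_add)
    then have "b \<longlonglongrightarrow> L + suminf e" by (simp add: h_def)
    then have "(\<lambda>n. (norm (w n - z))\<^sup>2) \<longlonglongrightarrow> (L + suminf e) / (1 - \<theta>)"
      using \<theta> by (intro affine_recurrence_tendsto[where b = b]) (auto simp: b_def)
    moreover have "summable p"
    proof (rule summableI_nonneg_bounded[OF p0])
      fix n
      have "(\<Sum>i<n. p i) \<le> (\<Sum>i<n. h i - h (Suc i))"
        using hp by (intro sum_mono) (smt (verit))
      also have "\<dots> = h 0 - h n" by (rule sum_lessThan_telescope')
      also have "\<dots> \<le> h 0 + K * (\<Sum>i. (D i)\<^sup>2) + E" using h_ge[of n] by linarith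
      finally show "(\<Sum>i<n. p i) \<le> h 0 + K * (\<Sum>i. (D i)\<^sup>2) + E" .
    qed
    ultimately show ?thesis unfolding p_def convergent_def by blast
  qed
  \<comment> \<open>Otherwise a positive multiple of a tail of \<open>\<beta>\<close> would be
    dominated by the summable sequence in \<open>key\<close>.\<close>
  have freq: "\<exists>n\<ge>N. f (u n) - f z0 < r" if "r > 0" for N r
  proof (rule ccontr)
    assume "\<not> ?thesis"
    then have ge: "f (u n) - f z0 \<ge> r" if "n \<ge> N" for n using that by force
    have "summable (\<lambda>n. 2 * \<beta> n * r)"
    proof (rule summable_comparison_test'[of _ N])
      show "summable (\<lambda>n. 2 * \<beta> n * (f (u n) - f z0))" using key[OF ex] by blast
      fix n assume "n \<ge> N"
      then show "norm (2 * \<beta> n * r) \<le> 2 * \<beta> n * (f (u n) - f z0)"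
        using ge[of n] \<beta>(1)[of n] \<open>r > 0\<close> by (simp add: mult_left_mono)
    qed
    then have "summable (\<lambda>n. (2 * r) * \<beta> n)" by (simp add: mult_ac)
    then show False using \<beta>(2) \<open>r > 0\<close> by (simp add: summable_cmult_iff)
  qed
  have "\<forall>k. \<exists>n\<ge>k. f (u n) - f z0 < 1 / real (Suc k)" using freq by simp
  then obtain \<nu> where \<nu>: "\<And>k. \<nu> k \<ge> k" "\<And>k. f (u (\<nu> k)) - f z0 < 1 / real (Suc k)" by metis
  have "Bseq (\<lambda>n. (norm (w n - z0))\<^sup>2)" using key[OF ex] convergent_imp_Bseq by blast
  then obtain B where B: "\<And>n. \<bar>(norm (w n - z0))\<^sup>2\<bar> \<le> B" unfolding Bseq_def by auto
  have Bw: "norm (w n) \<le> norm z0 + (B + 1)" for n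
  proof -
    have "norm (w n - z0) \<le> B + 1"
    proof (cases "norm (w n - z0) \<le> 1")
      case True then show ?thesis using B[of n] by (smt (verit))
    next
      case False
      then have "norm (w n - z0) \<le> (norm (w n - z0))\<^sup>2" by (intro self_le_power) auto
      then show ?thesis using B[of n] by auto
    qed
    then show ?thesis using norm_triangle_ineq[of z0 "w n - z0"] by simp
  qed
  have "bounded (range (\<lambda>k. w (Suc (\<nu> k))))" using Bw by (intro boundedI) auto
  then obtain z r where r: "strict_mono r" and wz: "((\<lambda>k. w (Suc (\<nu> k))) \<circ> r) \<longlonglongrightarrow> z"
    using bounded_imp_convergent_subsequence by blast
  \<comment> \<open>\<open>\<nu>\<close> need not be monotone, so limits along
    \<open>\<nu> (r k)\<close> are taken through \<open>filterlim\<close> instead of as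
    subsequences.\<close>
  have \<nu>r: "filterlim (\<lambda>k. \<nu> (r k)) at_top sequentially"
  proof (rule filterlim_at_top_mono[OF filterlim_ident])
    show "\<forall>\<^sub>F k in sequentially. k \<le> \<nu> (r k)"
      using \<nu>(1) seq_suble[OF r] by (intro always_eventually allI) (meson order_trans)
  qed
  have "(\<lambda>k. (u (\<nu> (r k)) - w (Suc (\<nu> (r k)))) + w (Suc (\<nu> (r k)))) \<longlonglongrightarrow> 0 + z"
    using filterlim_compose[OF uw \<nu>r] wz by (intro tendsto_add) (auto simp: o_def)
  then have uz: "(\<lambda>k. u (\<nu> (r k))) \<longlonglongrightarrow> z" by simp
  have zC: "z \<in> C" using closed_sequentially[OF C _ uz] u by simp
  have "(\<lambda>k. f (u (\<nu> (r k)))) \<longlonglongrightarrow> f z"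
    by (rule continuous_on_tendsto_compose[OF f uz zC]) (simp add: u)
  moreover have "(\<lambda>k. f z0 + 1 / real (Suc (r k))) \<longlonglongrightarrow> f z0 + 0"
    using LIMSEQ_subseq_LIMSEQ[OF LIMSEQ_Suc[OF lim_1_over_n] r]
    by (intro tendsto_add tendsto_const) (simp add: o_def)
  moreover have "f (u (\<nu> (r k))) \<le> f z0 + 1 / real (Suc (r k))" for k
    using \<nu>(2)[of "r k"] by linarith
  ultimately have "f z \<le> f z0 + 0" by (intro LIMSEQ_le) auto
  then have opt: "f z \<le> f y" if "y \<in> C" for y using ex(2)[OF that] by simp
  \<comment> \<open>The cluster point is a minimizer, so \<open>key\<close> applies to it as well:
    the full sequence of distances has a limit, which the subsequence identifies as 0.\<close>
  obtain l where l: "(\<lambda>n. (norm (w n - z))\<^sup>2) \<longlonglongrightarrow> l"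
    using key[OF zC opt] unfolding convergent_def by blast
  have "(\<lambda>k. (norm (w (Suc (\<nu> (r k))) - z))\<^sup>2) \<longlonglongrightarrow> (norm (z - z))\<^sup>2"
    using wz by (intro tendsto_intros) (simp add: o_def)
  moreover have "(\<lambda>k. (norm (w (Suc (\<nu> (r k))) - z))\<^sup>2) \<longlonglongrightarrow> l"
    using filterlim_compose[OF LIMSEQ_Suc[OF l] \<nu>r] by simp
  ultimately have "(norm (z - z))\<^sup>2 = l" by (rule LIMSEQ_unique)
  then have "l = 0" by simp
  then have "(\<lambda>n. sqrt ((norm (w n - z))\<^sup>2)) \<longlonglongrightarrow> sqrt 0"
    using l by (intro tendsto_real_sqrt) simp
  then have "(\<lambda>n. norm (w n - z)) \<longlonglongrightarrow> 0" by simp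
  then have "w \<longlonglongrightarrow> z" by (simp add: tendsto_norm_zero_iff LIM_zero_iff)
  then show ?thesis using zC opt by blast
qed

section \<open>Almost sure convergence of martingale series\<close>

text \<open>The partial sums are stopped when they first leave
  \<open>(-\<epsilon>, \<epsilon>)\<close>, which keeps the martingale transform bounded.\<close>
lemma (in prob_space) martingale_maximal_inequality:
  fixes F :: "nat \<Rightarrow> 'a measure" and X :: "nat \<Rightarrow> 'a \<Rightarrow> real"
  assumes sub: "\<And>n. subalgebra M (F n)" and mono: "\<And>n. subalgebra (F (Suc n)) (F n)"
    and X: "\<And>n. X n \<in> borel_measurable (F (Suc n))"
    and X2: "\<And>n. integrable M (\<lambda>\<omega>. (X n \<omega>)\<^sup>2)"
    and sumX: "summable (\<lambda>n. expectation (\<lambda>\<omega>. (X n \<omega>)\<^sup>2))"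
    and orth: "\<And>n \<phi> B. \<phi> \<in> borel_measurable (F n) \<Longrightarrow> (\<And>\<omega>. \<bar>\<phi> \<omega>\<bar> \<le> B) \<Longrightarrow>
      expectation (\<lambda>\<omega>. \<phi> \<omega> * X n \<omega>) = 0"
    and \<epsilon>: "\<epsilon> > 0"
  shows "prob {\<omega> \<in> space M. \<exists>j. \<bar>\<Sum>i<j. X (m + i) \<omega>\<bar> \<ge> \<epsilon>}
    \<le> (\<Sum>n. expectation (\<lambda>\<omega>. (X (n + m) \<omega>)\<^sup>2)) / \<epsilon>\<^sup>2"
proof -
  have XM [measurable]: "X n \<in> borel_measurable M" for n
    using measurable_from_subalg[OF sub X] .
  have Xint: "integrable M (X n)" for n
    using square_integrable_imp_integrable[OF XM X2] .
  define Z where "Z = rec_nat (\<lambda>_. 0) (\<lambda>k z \<omega>. z \<omega> + (if \<bar>z \<omega>\<bar> < \<epsilon> then X (m + k) \<omega> else 0))"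
  have Z0: "Z 0 = (\<lambda>_. 0)" by (simp add: Z_def)
  have ZS: "Z (Suc k) = (\<lambda>\<omega>. Z k \<omega> + (if \<bar>Z k \<omega>\<bar> < \<epsilon> then X (m + k) \<omega> else 0))" for k
    by (simp add: Z_def)
  have ZF: "Z k \<in> borel_measurable (F (m + k))" for k
  proof (induction k)
    case 0 show ?case by (simp add: Z0)
  next
    case (Suc k)
    have [measurable]: "Z k \<in> borel_measurable (F (Suc (m + k)))"
      using measurable_from_subalg[OF mono Suc] .
    have [measurable]: "X (m + k) \<in> borel_measurable (F (Suc (m + k)))" by (rule X)
    show ?case unfolding ZS by simp
  qed
  have ZM [measurable]: "Z k \<in> borel_measurable M" for k
    using measurable_from_subalg[OF sub ZF] .
  have EZ: "integrable M (\<lambda>\<omega>. (Z k \<omega>)\<^sup>2) \<and>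
      expectation (\<lambda>\<omega>. (Z k \<omega>)\<^sup>2) \<le> (\<Sum>i<k. expectation (\<lambda>\<omega>. (X (i + m) \<omega>)\<^sup>2))" for k
  proof (induction k)
    case 0 show ?case by (simp add: Z0)
  next
    case (Suc k)
    \<comment> \<open>The cross term in the square of \<open>Z (Suc k)\<close> is
      \<open>2 * \<phi> * X\<close>; the cutoff bounds \<open>\<phi>\<close> by
      \<open>\<epsilon>\<close>, so that \<open>orth\<close> removes it in expectation.\<close>
    define \<phi> where "\<phi> \<omega> = (if \<bar>Z k \<omega>\<bar> < \<epsilon> then Z k \<omega> else 0)" for \<omega>
    define \<psi> where "\<psi> \<omega> = (if \<bar>Z k \<omega>\<bar> < \<epsilon> then (X (m + k) \<omega>)\<^sup>2 else 0)" for \<omega>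
    have \<phi>_le: "\<bar>\<phi> \<omega>\<bar> \<le> \<epsilon>" for \<omega> using \<epsilon> by (simp add: \<phi>_def)
    have [measurable]: "Z k \<in> borel_measurable (F (m + k))" by (rule ZF)
    have \<phi>F: "\<phi> \<in> borel_measurable (F (m + k))" unfolding \<phi>_def by simp
    have [measurable]: "\<phi> \<in> borel_measurable M" unfolding \<phi>_def by simp
    have [measurable]: "\<psi> \<in> borel_measurable M" unfolding \<psi>_def by simp
    have i1: "integrable M (\<lambda>\<omega>. \<phi> \<omega> * X (m + k) \<omega>)"
    proof (rule Bochner_Integration.integrable_bound)
      show "integrable M (\<lambda>\<omega>. \<epsilon> * X (m + k) \<omega>)" using Xint by simp
      show "AE \<omega> in M. norm (\<phi> \<omega> * X (m + k) \<omega>) \<le> norm (\<epsilon> * X (m + k) \<omega>)"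
        using \<phi>_le \<epsilon> by (auto simp: abs_mult intro!: mult_right_mono)
    qed simp
    have i2: "integrable M \<psi>"
      by (rule Bochner_Integration.integrable_bound[OF X2[of "m + k"]]) (auto simp: \<psi>_def)
    have eq: "(Z (Suc k) \<omega>)\<^sup>2 = (Z k \<omega>)\<^sup>2 + 2 * (\<phi> \<omega> * X (m + k) \<omega>) + \<psi> \<omega>" for \<omega>
      by (simp add: ZS \<phi>_def \<psi>_def power2_eq_square algebra_simps)
    have "expectation (\<lambda>\<omega>. (Z (Suc k) \<omega>)\<^sup>2)
        = expectation (\<lambda>\<omega>. (Z k \<omega>)\<^sup>2) + 2 * expectation (\<lambda>\<omega>. \<phi> \<omega> * X (m + k) \<omega>) + expectation \<psi>"
      unfolding eq using Suc i1 i2 by simp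
    also have "expectation (\<lambda>\<omega>. \<phi> \<omega> * X (m + k) \<omega>) = 0" using orth[OF \<phi>F \<phi>_le] .
    also have "expectation \<psi> \<le> expectation (\<lambda>\<omega>. (X (k + m) \<omega>)\<^sup>2)"
      using i2 X2 by (intro integral_mono) (auto simp: \<psi>_def add.commute)
    finally show ?case unfolding eq using Suc i1 i2 by simp
  qed
  define S where "S = (\<Sum>n. expectation (\<lambda>\<omega>. (X (n + m) \<omega>)\<^sup>2))"
  define A where "A k = {\<omega> \<in> space M. \<exists>j\<le>k. \<bar>\<Sum>i<j. X (m + i) \<omega>\<bar> \<ge> \<epsilon>}" for k
  have AM [measurable]: "A k \<in> sets M" for k unfolding A_def by measurable
  \<comment> \<open>A frozen sum stays outside the interval, so an exit at any time up to
    \<open>k\<close> can be read off the single value \<open>Z k\<close>, to which Markov's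
    inequality applies.\<close>
  have stop: "\<bar>Z k \<omega>\<bar> \<ge> \<epsilon> \<or>
      (Z k \<omega> = (\<Sum>i<k. X (m + i) \<omega>) \<and> (\<forall>j\<le>k. \<bar>\<Sum>i<j. X (m + i) \<omega>\<bar> < \<epsilon>))" for k \<omega>
  proof (induction k)
    case 0 show ?case using \<epsilon> by (simp add: Z0)
  next
    case (Suc k)
    then show ?case by (auto simp: ZS le_Suc_eq not_less)
  qed
  have PA: "prob (A k) \<le> S / \<epsilon>\<^sup>2" for k
  proof -
    have "prob (A k) \<le> prob {\<omega> \<in> space M. (Z k \<omega>)\<^sup>2 \<ge> \<epsilon>\<^sup>2}"
    proof (rule finite_measure_mono)
      have "\<bar>Z k \<omega>\<bar> \<ge> \<epsilon> \<Longrightarrow> (Z k \<omega>)\<^sup>2 \<ge> \<epsilon>\<^sup>2" for \<omega> using \<epsilon> power_mono[of \<epsilon> "\<bar>Z k \<omega>\<bar>" 2] by simp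
      then show "A k \<subseteq> {\<omega> \<in> space M. (Z k \<omega>)\<^sup>2 \<ge> \<epsilon>\<^sup>2}"
        using stop[of k] unfolding A_def by (auto simp: not_less) (meson leD)
    qed simp
    also have "\<dots> \<le> expectation (\<lambda>\<omega>. (Z k \<omega>)\<^sup>2) / \<epsilon>\<^sup>2"
      using EZ \<epsilon> by (intro integral_Markov_inequality_measure[where A = "{}"]) auto
    also have "\<dots> \<le> S / \<epsilon>\<^sup>2"
    proof (rule divide_right_mono)
      have "(\<Sum>i<k. expectation (\<lambda>\<omega>. (X (i + m) \<omega>)\<^sup>2)) \<le> S"
        unfolding S_def using sumX by (intro sum_le_suminf) (auto intro: summable_ignore_initial_segment)
      then show "expectation (\<lambda>\<omega>. (Z k \<omega>)\<^sup>2) \<le> S" using EZ[of k] by linarith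
    qed simp
    finally show ?thesis .
  qed
  have "incseq A" by (intro incseq_SucI) (auto simp: A_def intro: le_SucI)
  then have "(\<lambda>k. prob (A k)) \<longlonglongrightarrow> prob (\<Union>k. A k)"
    using AM by (intro finite_Lim_measure_incseq) auto
  then have "prob (\<Union>k. A k) \<le> S / \<epsilon>\<^sup>2" using PA by (intro LIMSEQ_le_const2) auto
  also have "(\<Union>k. A k) = {\<omega> \<in> space M. \<exists>j. \<bar>\<Sum>i<j. X (m + i) \<omega>\<bar> \<ge> \<epsilon>}"
    by (auto simp: A_def)
  finally show ?thesis unfolding S_def .
qed

text \<open>The tail variances \<open>R m\<close> tend to 0, so the event that for every
  \<open>m\<close> the sums started at \<open>m\<close> reach size \<open>\<epsilon>\<close> is
  null. Countably many \<open>\<epsilon>\<close> give the Cauchy criterion. The hypothesis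
  \<open>orth\<close> expresses a vanishing conditional expectation given \<open>F n\<close> by
  testing against bounded functions.\<close>

lemma (in prob_space) martingale_differences_summable:
  fixes F :: "nat \<Rightarrow> 'a measure" and X :: "nat \<Rightarrow> 'a \<Rightarrow> real"
  assumes sub: "\<And>n. subalgebra M (F n)" and mono: "\<And>n. subalgebra (F (Suc n)) (F n)"
    and X: "\<And>n. X n \<in> borel_measurable (F (Suc n))"
    and X2: "\<And>n. integrable M (\<lambda>\<omega>. (X n \<omega>)\<^sup>2)"
    and sumX: "summable (\<lambda>n. expectation (\<lambda>\<omega>. (X n \<omega>)\<^sup>2))"
    and orth: "\<And>n \<phi> B. \<phi> \<in> borel_measurable (F n) \<Longrightarrow> (\<And>\<omega>. \<bar>\<phi> \<omega>\<bar> \<le> B) \<Longrightarrow>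
      expectation (\<lambda>\<omega>. \<phi> \<omega> * X n \<omega>) = 0"
  shows "AE \<omega> in M. summable (\<lambda>n. X n \<omega>)"
proof -
  have XM [measurable]: "X n \<in> borel_measurable M" for n
    using measurable_from_subalg[OF sub X] .
  define R where "R m = (\<Sum>n. expectation (\<lambda>\<omega>. (X (n + m) \<omega>)\<^sup>2))" for m
  have R0: "R \<longlonglongrightarrow> 0"
  proof -
    have "R = (\<lambda>m. (\<Sum>n. expectation (\<lambda>\<omega>. (X n \<omega>)\<^sup>2)) - (\<Sum>n<m. expectation (\<lambda>\<omega>. (X n \<omega>)\<^sup>2)))"
      unfolding R_def using suminf_minus_initial_segment[OF sumX] by simp
    then show ?thesis using summable_LIMSEQ[OF sumX] by (auto intro!: tendsto_eq_intros)
  qed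
  have cauchy: "AE \<omega> in M. \<exists>m. \<forall>j. \<bar>\<Sum>i<j. X (m + i) \<omega>\<bar> < \<epsilon>" if "\<epsilon> > 0" for \<epsilon>
  proof -
    define B where "B m = {\<omega> \<in> space M. \<exists>j. \<bar>\<Sum>i<j. X (m + i) \<omega>\<bar> \<ge> \<epsilon>}" for m
    have BM [measurable]: "B m \<in> sets M" for m unfolding B_def by measurable
    have "prob (\<Inter>m. B m) \<le> R m / \<epsilon>\<^sup>2" for m
    proof -
      have "prob (\<Inter>m. B m) \<le> prob (B m)" by (intro finite_measure_mono) auto
      also have "\<dots> \<le> R m / \<epsilon>\<^sup>2" unfolding B_def R_def
        by (rule martingale_maximal_inequality[OF sub mono X X2 sumX orth that])
      finally show ?thesis .
    qed
    moreover have "(\<lambda>m. R m / \<epsilon>\<^sup>2) \<longlonglongrightarrow> 0 / \<epsilon>\<^sup>2" using R0 that by (intro tendsto_intros) auto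
    ultimately have "prob (\<Inter>m. B m) \<le> 0" using LIMSEQ_le_const by fastforce
    then have "prob (\<Inter>m. B m) = 0" by (simp add: measure_le_0_iff)
    then have "(\<Inter>m. B m) \<in> null_sets M" by (intro null_setsI) (auto simp: emeasure_eq_measure)
    then have "AE \<omega> in M. \<omega> \<notin> (\<Inter>m. B m)" by (rule AE_not_in)
    then show ?thesis using AE_space by eventually_elim (auto simp: B_def not_le)
  qed
  have "AE \<omega> in M. \<forall>p. \<exists>m. \<forall>j. \<bar>\<Sum>i<j. X (m + i) \<omega>\<bar> < 1 / real (Suc p)"
    using cauchy by (subst AE_all_countable) simp
  then show ?thesis
  proof eventually_elim
    case (elim \<omega>)
    show ?case unfolding summable_Cauchy
    proof (intro allI impI)
      fix e :: real assume "e > 0"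
      then obtain p where p: "1 / real (Suc p) < e / 2" using nat_approx_posE[of "e / 2"] by auto
      obtain m where m: "\<And>j. \<bar>\<Sum>i<j. X (m + i) \<omega>\<bar> < 1 / real (Suc p)" using elim by blast
      show "\<exists>N. \<forall>k\<ge>N. \<forall>n. norm (\<Sum>i\<in>{k..<n}. X i \<omega>) < e"
      proof (intro exI allI impI)
        fix k n assume k: "k \<ge> m"
        have shift: "(\<Sum>i\<in>{m..<l}. X i \<omega>) = (\<Sum>i<l - m. X (m + i) \<omega>)" if "l \<ge> m" for l
          using that sum.shift_bounds_nat_ivl[of "\<lambda>i. X i \<omega>" 0 m "l - m"]
          by (simp add: atLeast0LessThan add.commute)
        show "norm (\<Sum>i\<in>{k..<n}. X i \<omega>) < e"
        proof (cases "k \<le> n")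
          \<comment> \<open>A block starting at \<open>k\<close> is the difference of two blocks
            starting at \<open>m\<close>, each smaller than \<open>e / 2\<close>.\<close>
          case True
          have "(\<Sum>i\<in>{m..<n}. X i \<omega>) = (\<Sum>i\<in>{m..<k}. X i \<omega>) + (\<Sum>i\<in>{k..<n}. X i \<omega>)"
            using k True by (simp add: sum.atLeastLessThan_concat)
          then show ?thesis
            using shift[of n] shift[of k] k True m[of "n - m"] m[of "k - m"] p by auto
        qed (use \<open>e > 0\<close> in auto)
      qed
    qed
  qed
qed

section \<open>The past and the independence of the fresh sample\<close>

text \<open>The sigma-algebra generated by the first \<open>n\<close> samples, encoded as a pullback
  along one tuple so that independence of tuples over disjoint index sets applies to it.\<close>

definition past_algebra :: "'w measure \<Rightarrow> 's measure \<Rightarrow> (nat \<Rightarrow> 'w \<Rightarrow> 's) \<Rightarrow> nat \<Rightarrow> 'w measure" where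
  "past_algebra M S \<zeta> n =
     vimage_algebra (space M) (\<lambda>\<omega>. \<lambda>i\<in>{..<n}. \<zeta> i \<omega>) (Pi\<^sub>M {..<n} (\<lambda>_. S))"

lemma subalgebra_vimage_algebra:
  assumes "f \<in> measurable M N"
  shows "subalgebra M (vimage_algebra (space M) f N)"
  using assms unfolding subalgebra_def
  by (auto simp: sets_vimage_algebra2[OF measurable_space[OF assms, THEN Pi_I]] measurable_sets)

lemma subalgebra_past_algebra:
  assumes "\<And>i. \<zeta> i \<in> measurable M S"
  shows "subalgebra M (past_algebra M S \<zeta> n)"
  unfolding past_algebra_def using assms by (intro subalgebra_vimage_algebra) measurable

lemma coordinate_measurable_past_algebra:
  assumes \<zeta>: "\<And>i. \<zeta> i \<in> measurable M S" and "i < n"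
  shows "\<zeta> i \<in> measurable (past_algebra M S \<zeta> n) S"
proof -
  have "(\<lambda>\<omega>. \<lambda>i\<in>{..<n}. \<zeta> i \<omega>) \<in> measurable (past_algebra M S \<zeta> n) (Pi\<^sub>M {..<n} (\<lambda>_. S))"
    unfolding past_algebra_def using measurable_space[OF \<zeta>]
    by (intro measurable_vimage_algebra1) (auto simp: space_PiM)
  from measurable_compose[OF this measurable_component_singleton[of i]] \<open>i < n\<close>
  show ?thesis by simp
qed

lemma subalgebra_past_algebra_Suc:
  assumes \<zeta>: "\<And>i. \<zeta> i \<in> measurable M S"
  shows "subalgebra (past_algebra M S \<zeta> (Suc n)) (past_algebra M S \<zeta> n)"
proof -
  have [measurable]: "\<zeta> i \<in> measurable (past_algebra M S \<zeta> (Suc n)) S" if "i < n" for i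
    using coordinate_measurable_past_algebra[OF \<zeta>] that by simp
  have "(\<lambda>\<omega>. \<lambda>i\<in>{..<n}. \<zeta> i \<omega>) \<in> measurable (past_algebra M S \<zeta> (Suc n)) (Pi\<^sub>M {..<n} (\<lambda>_. S))"
    by (intro measurable_restrict) simp
  from subalgebra_vimage_algebra[OF this] show ?thesis by (simp add: past_algebra_def)
qed

text \<open>Events indexed by \<open>J\<close> are transported to the image of \<open>J\<close> by
  the inverse of \<open>h\<close>. This allows the samples to be renumbered by a shift.\<close>

lemma (in prob_space) indep_vars_reindex:
  assumes indep: "indep_vars N X (h ` I)" and inj: "inj_on h I"
  shows "indep_vars (\<lambda>i. N (h i)) (\<lambda>i. X (h i)) I"
proof -
  define G where "G k = {X k -` A \<inter> space M | A. A \<in> sets (N k)}" for k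
  have "indep_sets (\<lambda>i. G (h i)) I"
  proof (rule indep_setsI)
    show "G (h i) \<subseteq> events" if "i \<in> I" for i
      using indep that unfolding indep_vars_def2 indep_sets_def G_def by blast
    fix A J assume J: "J \<noteq> {}" "J \<subseteq> I" "finite J" "\<forall>j\<in>J. A j \<in> G (h j)"
    have injJ: "inj_on h J" using inj J(2) by (rule inj_on_subset)
    define A' where "A' = A \<circ> inv_into J h"
    have A': "A' (h j) = A j" if "j \<in> J" for j
      using that injJ by (simp add: A'_def inv_into_f_f)
    have "prob (\<Inter>k\<in>h ` J. A' k) = (\<Prod>k\<in>h ` J. prob (A' k))"
      using indep J A' unfolding indep_vars_def2 G_def[symmetric]
      by (intro indep_setsD[where F = G and I = "h ` I"]) auto
    then show "prob (\<Inter>j\<in>J. A j) = (\<Prod>j\<in>J. prob (A j))"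
      using A' by (simp add: prod.reindex[OF injJ] cong: INF_cong_simp)
  qed
  then show ?thesis using indep unfolding indep_vars_def2 G_def by blast
qed

text \<open>A past event is a preimage under the tuple of samples with index below \<open>n\<close>,
  and this tuple is independent of the one-element tuple at \<open>n\<close>.\<close>

lemma (in prob_space) past_algebra_independent:
  assumes indep: "indep_vars (\<lambda>_. S) \<zeta> UNIV"
    and A: "A \<in> sets (past_algebra M S \<zeta> n)" and B: "B \<in> sets S"
  shows "prob (A \<inter> \<zeta> n -` B) = prob A * prob (\<zeta> n -` B \<inter> space M)"
proof -
  have \<zeta>: "\<zeta> i \<in> measurable M S" for i using indep by (auto simp: indep_vars_def)
  define U where "U J = (\<lambda>\<omega>. \<lambda>i\<in>J. \<zeta> i \<omega>)" for J
  have UM: "U J \<in> measurable M (Pi\<^sub>M J (\<lambda>_. S))" for J unfolding U_def using \<zeta> by measurable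
  have iU: "indep_var (Pi\<^sub>M {..<n} (\<lambda>_. S)) (U {..<n}) (Pi\<^sub>M {n} (\<lambda>_. S)) (U {n})"
    unfolding U_def by (rule indep_var_restrict[OF indep]) auto
  obtain A' where A': "A' \<in> sets (Pi\<^sub>M {..<n} (\<lambda>_. S))" "A = U {..<n} -` A' \<inter> space M"
    using A sets_vimage_algebra2[of "U {..<n}" "space M" "Pi\<^sub>M {..<n} (\<lambda>_. S)"]
      measurable_space[OF UM]
    unfolding past_algebra_def U_def[symmetric] by blast
  define B' where "B' = (\<lambda>u. u n) -` B \<inter> space (Pi\<^sub>M {n} (\<lambda>_. S))"
  have B': "B' \<in> sets (Pi\<^sub>M {n} (\<lambda>_. S))"
    unfolding B'_def using B by (intro measurable_sets[OF measurable_component_singleton]) auto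
  have UB: "U {n} -` B' \<inter> space M = \<zeta> n -` B \<inter> space M"
    using measurable_space[OF UM, of _ "{n}"] by (auto simp: B'_def U_def)
  have "A \<inter> \<zeta> n -` B = (\<lambda>\<omega>. (U {..<n} \<omega>, U {n} \<omega>)) -` (A' \<times> B') \<inter> space M"
    using UB A' by blast
  then show ?thesis
    using indep_varD[OF iU A'(1) B'] UB A'(2) by simp
qed

text \<open>The pair of \<open>Z\<close> and \<open>\<zeta> n\<close> has a product law, so Fubini
  integrates out the fresh sample with \<open>Z\<close> frozen. This takes the place of conditional
  expectations.\<close>

lemma (in prob_space) past_algebra_integral:
  fixes h :: "_ \<Rightarrow> 'b::{banach, second_countable_topology}"
  assumes indep: "indep_vars (\<lambda>_. S) \<zeta> UNIV"
    and Z: "Z \<in> measurable (past_algebra M S \<zeta> n) N"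
    and h: "h \<in> borel_measurable (N \<Otimes>\<^sub>M S)"
    and int: "integrable M (\<lambda>\<omega>. h (Z \<omega>, \<zeta> n \<omega>))"
  shows "expectation (\<lambda>\<omega>. h (Z \<omega>, \<zeta> n \<omega>))
    = expectation (\<lambda>\<omega>. \<integral>s. h (Z \<omega>, s) \<partial>distr M S (\<zeta> n))"
proof -
  have \<zeta>: "\<zeta> i \<in> measurable M S" for i using indep by (auto simp: indep_vars_def)
  have sub: "subalgebra M (past_algebra M S \<zeta> n)" using \<zeta> by (rule subalgebra_past_algebra)
  have ZM: "Z \<in> measurable M N" using measurable_from_subalg[OF sub Z] .
  have ZY: "(\<lambda>\<omega>. (Z \<omega>, \<zeta> n \<omega>)) \<in> measurable M (N \<Otimes>\<^sub>M S)" using ZM \<zeta> by measurable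
  interpret Z: prob_space "distr M N Z" using ZM by (rule prob_space_distr)
  interpret Y: prob_space "distr M S (\<zeta> n)" using \<zeta> by (rule prob_space_distr)
  interpret pair_sigma_finite "distr M N Z" "distr M S (\<zeta> n)" ..
  have eq: "distr M N Z \<Otimes>\<^sub>M distr M S (\<zeta> n) = distr M (N \<Otimes>\<^sub>M S) (\<lambda>\<omega>. (Z \<omega>, \<zeta> n \<omega>))"
  proof (rule pair_measure_eqI)
    fix A B assume "A \<in> sets (distr M N Z)" "B \<in> sets (distr M S (\<zeta> n))"
    then have A: "A \<in> sets N" and B: "B \<in> sets S" by auto
    have ZA: "Z -` A \<inter> space M \<in> sets (past_algebra M S \<zeta> n)"
      using measurable_sets[OF Z A] sub by (simp add: subalgebra_def)
    have "prob ((\<lambda>\<omega>. (Z \<omega>, \<zeta> n \<omega>)) -` (A \<times> B) \<inter> space M)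
        = prob ((Z -` A \<inter> space M) \<inter> \<zeta> n -` B)" by (rule arg_cong[of _ _ prob]) auto
    also have "\<dots> = prob (Z -` A \<inter> space M) * prob (\<zeta> n -` B \<inter> space M)"
      by (rule past_algebra_independent[OF indep ZA B])
    finally show "emeasure (distr M N Z) A * emeasure (distr M S (\<zeta> n)) B
        = emeasure (distr M (N \<Otimes>\<^sub>M S) (\<lambda>\<omega>. (Z \<omega>, \<zeta> n \<omega>))) (A \<times> B)"
      using A B ZM \<zeta> ZY by (simp add: emeasure_distr emeasure_eq_measure ennreal_mult)
  qed (auto intro: Z.sigma_finite_measure_axioms Y.sigma_finite_measure_axioms
      cong: sets_pair_measure_cong)
  have "expectation (\<lambda>\<omega>. h (Z \<omega>, \<zeta> n \<omega>)) = (\<integral>p. h p \<partial>(distr M N Z \<Otimes>\<^sub>M distr M S (\<zeta> n)))"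
    unfolding eq by (rule integral_distr[OF ZY h, symmetric])
  also have "\<dots> = (\<integral>z. (\<integral>s. h (z, s) \<partial>distr M S (\<zeta> n)) \<partial>distr M N Z)"
    using int integrable_distr_eq[OF ZY h] by (intro integral_fst'[symmetric]) (simp add: eq)
  also have "\<dots> = expectation (\<lambda>\<omega>. \<integral>s. h (Z \<omega>, s) \<partial>distr M S (\<zeta> n))"
    by (rule integral_distr[OF ZM]) (use h in \<open>auto intro!: Y.borel_measurable_lebesgue_integral\<close>)
  finally show ?thesis .
qed

section \<open>The stochastic iteration under sure bounds\<close>

lemma square_add_le: "(a + b)\<^sup>2 \<le> 2 * a\<^sup>2 + 2 * (b::real)\<^sup>2"
  using sum_squares_bound[of a b] by (simp add: power2_sum)

lemma (in prob_space) integrable_bounded: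
  fixes X :: "'a \<Rightarrow> real"
  assumes "X \<in> borel_measurable M" "\<And>\<omega>. \<omega> \<in> space M \<Longrightarrow> \<bar>X \<omega>\<bar> \<le> B"
  shows "integrable M X"
  using assms by (intro integrable_const_bound[of _ B]) auto

text \<open>Index \<open>n\<close> stands for \<open>v (n + 1)\<close> of the method,
  \<open>\<beta> n\<close> for \<open>\<alpha> (n + 2)\<close>, and \<open>s n\<close> for the
  sample with index \<open>n + 3\<close>.\<close>

fun momentum_path ::
  "'a::euclidean_space set \<Rightarrow> ('a \<Rightarrow> 's \<Rightarrow> 'a) \<Rightarrow> (nat \<Rightarrow> real) \<Rightarrow> real \<Rightarrow> 'a \<Rightarrow> 'a \<Rightarrow> (nat \<Rightarrow> 's) \<Rightarrow> nat \<Rightarrow> 'a"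
where
  "momentum_path C g \<beta> \<theta> a1 a2 s 0 = a1"
| "momentum_path C g \<beta> \<theta> a1 a2 s (Suc 0) = a2"
| "momentum_path C g \<beta> \<theta> a1 a2 s (Suc (Suc n)) =
     (let y = (1 + \<theta>) *\<^sub>R momentum_path C g \<beta> \<theta> a1 a2 s (Suc n) - \<theta> *\<^sub>R momentum_path C g \<beta> \<theta> a1 a2 s n
      in closest_point C (y - \<beta> n *\<^sub>R g y (s n)))"

text \<open>Only the mean of \<open>g y\<close> has to be a subgradient of \<open>f\<close>; the
  functions of the single samples no longer appear. The bound on \<open>g\<close> holds for every
  sample, so pathwise estimates hold at every point of the sample space and inductions over
  \<open>n\<close> meet no null sets.\<close>

locale stochastic_momentum = prob_space P for P :: "'w measure" +
  fixes S :: "'s measure" and \<nu> :: "'s measure" and \<zeta> :: "nat \<Rightarrow> 'w \<Rightarrow> 's"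
    and g :: "'a::euclidean_space \<Rightarrow> 's \<Rightarrow> 'a" and f :: "'a \<Rightarrow> real" and C :: "'a set"
    and \<beta> :: "nat \<Rightarrow> real" and \<theta> L :: real and a1 a2 z0 :: 'a
  assumes indep: "indep_vars (\<lambda>_. S) \<zeta> UNIV"
    and distr_\<zeta>: "\<And>n. distr P S (\<zeta> n) = \<nu>"
    and g_meas: "(\<lambda>(y, s). g y s) \<in> borel_measurable (borel \<Otimes>\<^sub>M S)"
    and g_le: "\<And>y s. s \<in> space S \<Longrightarrow> norm (g y s) \<le> L"
    and subgradient: "\<And>y y'. f y + (\<integral>s. g y s \<partial>\<nu>) \<bullet> (y' - y) \<le> f y'"
    and C: "closed C" "convex C"
    and optimal: "z0 \<in> C" "\<And>y. y \<in> C \<Longrightarrow> f z0 \<le> f y"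
    and \<beta>: "\<And>n. 0 \<le> \<beta> n" "\<not> summable \<beta>" "summable (\<lambda>n. (\<beta> n)\<^sup>2)"
    and \<theta>: "0 < \<theta>" "\<theta> < 1"
begin

abbreviation "past \<equiv> past_algebra P S \<zeta>"

definition "w n \<omega> = momentum_path C g \<beta> \<theta> a1 a2 (\<lambda>i. \<zeta> i \<omega>) n"
definition "y n \<omega> = (1 + \<theta>) *\<^sub>R w (Suc n) \<omega> - \<theta> *\<^sub>R w n \<omega>"
definition "gbar x = (\<integral>s. g x s \<partial>\<nu>)"
definition "noise n \<omega> = g (y n \<omega>) (\<zeta> n \<omega>) - gbar (y n \<omega>)"

text \<open>The starting point \<^term>\<open>a2\<close> need not lie in \<^term>\<open>C\<close>; every other \<^term>\<open>u n \<omega>\<close>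
  equals \<^term>\<open>w (Suc n) \<omega>\<close>.\<close>
definition "u n \<omega> = closest_point C (w (Suc n) \<omega>)"
definition "e n = (if n = 0 then norm (closest_point C a2 - a2) else 0)"
definition "D = rec_nat (norm (a2 - a1)) (\<lambda>n d. \<theta> * d + (\<beta> n * L + e n))"
definition "lyap z n \<omega> = (norm (w (Suc n) \<omega> - z))\<^sup>2 - \<theta> * (norm (w n \<omega> - z))\<^sup>2"
text \<open>The costs of one step: the excess of the squared norm due to extrapolation, the squared
  subgradient step, and the Lipschitz cost of evaluating \<open>f\<close> at \<open>u n\<close>
  instead of \<open>y n\<close>.\<close>

definition "err n = \<theta> * (1 + \<theta>) * (D n)\<^sup>2 + (\<beta> n)\<^sup>2 * L\<^sup>2 + 2 * \<beta> n * (L * (e n + \<theta> * D n))"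

lemma C_ne: "C \<noteq> {}" using optimal by auto

lemma \<zeta>_meas [measurable]: "\<zeta> i \<in> measurable P S"
  using indep by (auto simp: indep_vars_def)

lemma sub_past: "subalgebra P (past n)" by (rule subalgebra_past_algebra) simp

lemma past_Suc: "subalgebra (past (Suc n)) (past n)"
  by (rule subalgebra_past_algebra_Suc) simp

lemma past_meas: "Z \<in> measurable (past n) N \<Longrightarrow> Z \<in> measurable P N"
  using measurable_from_subalg[OF sub_past] .

lemma prob_space_\<nu>: "prob_space \<nu>"
  unfolding distr_\<zeta>[of 0, symmetric] by (rule prob_space_distr) simp

lemma sets_\<nu> [measurable_cong]: "sets \<nu> = sets S" and space_\<nu> [simp]: "space \<nu> = space S"
  unfolding distr_\<zeta>[of 0, symmetric] by simp_all

lemma g_measurable [measurable (raw)]: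
  assumes "h \<in> borel_measurable N" "k \<in> measurable N S"
  shows "(\<lambda>x. g (h x) (k x)) \<in> borel_measurable N"
  using measurable_compose[OF measurable_Pair[OF assms] g_meas] by simp

lemma L_nonneg: "0 \<le> L"
proof -
  interpret \<nu>: prob_space \<nu> by (rule prob_space_\<nu>)
  obtain s where "s \<in> space S" using \<nu>.not_empty by auto
  then show ?thesis using g_le norm_ge_zero order_trans by blast
qed

lemma integrable_g: "integrable \<nu> (g x)"
proof -
  interpret \<nu>: prob_space \<nu> by (rule prob_space_\<nu>)
  show ?thesis by (rule \<nu>.integrable_const_bound[of _ L]) (auto simp: g_le)
qed

lemma gbar_le: "norm (gbar x) \<le> L"
proof -
  interpret \<nu>: prob_space \<nu> by (rule prob_space_\<nu>)
  have "norm (gbar x) \<le> (\<integral>s. norm (g x s) \<partial>\<nu>)" unfolding gbar_def by (rule integral_norm_bound)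
  also have "\<dots> \<le> (\<integral>s. L \<partial>\<nu>)"
    using integrable_g by (intro integral_mono) (auto simp: g_le)
  finally show ?thesis using \<nu>.prob_space by simp
qed

lemma gbar_measurable [measurable]: "gbar \<in> borel_measurable borel"
proof -
  interpret \<nu>: prob_space \<nu> by (rule prob_space_\<nu>)
  show ?thesis unfolding gbar_def by measurable
qed

text \<open>The mean subgradients have norm at most \<open>L\<close>; the subgradient inequality is
  used at both points.\<close>

lemma f_lipschitz: "\<bar>f x - f x'\<bar> \<le> L * norm (x - x')"
proof -
  have "f a - f b \<le> L * norm (a - b)" for a b
  proof -
    have "f a - f b \<le> gbar a \<bullet> (a - b)"
      using subgradient[of a b] by (simp add: gbar_def inner_diff_right)
    also have "\<dots> \<le> norm (gbar a) * norm (a - b)" by (rule norm_cauchy_schwarz)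
    also have "\<dots> \<le> L * norm (a - b)" using gbar_le by (rule mult_right_mono) simp
    finally show ?thesis .
  qed
  from this[of x x'] this[of x' x] show ?thesis by (simp add: norm_minus_commute)
qed

lemma continuous_f: "continuous_on A f"
proof -
  have "L-lipschitz_on A f"
    using f_lipschitz L_nonneg by (intro lipschitz_onI) (auto simp: dist_real_def dist_norm)
  then show ?thesis by (rule lipschitz_on_continuous_on)
qed

lemma closest_point_measurable [measurable]: "closest_point C \<in> borel_measurable borel"
  using continuous_on_closest_point[OF C(2,1) C_ne] by (intro borel_measurable_continuous_onI)

lemma w_Suc: "w (Suc (Suc n)) \<omega> = closest_point C (y n \<omega> - \<beta> n *\<^sub>R g (y n \<omega>) (\<zeta> n \<omega>))"
  by (simp add: w_def y_def Let_def)

text \<open>The first iterate that uses \<open>\<zeta> n\<close> is \<open>w (Suc (Suc n))\<close>.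
  Hence the query point \<open>y n\<close> is determined by the past, while the sample evaluated
  there is fresh.\<close>

lemma w_past: "w n \<in> borel_measurable (past n)" "w (Suc n) \<in> borel_measurable (past n)"
proof (induction n)
  case 0
  { case 1 show ?case by (simp add: w_def) }
  { case 2 show ?case by (simp add: w_def) }
next
  case (Suc n)
  note mono = measurable_from_subalg[OF past_Suc]
  have [measurable]: "w n \<in> borel_measurable (past (Suc n))" "w (Suc n) \<in> borel_measurable (past (Suc n))"
    using Suc by (auto intro: mono)
  have [measurable]: "\<zeta> n \<in> measurable (past (Suc n)) S"
    by (rule coordinate_measurable_past_algebra) auto
  { case 1 show ?case by simp }
  { case 2 show ?case unfolding w_Suc y_def by measurable }
qed

lemma y_past [measurable]: "y n \<in> borel_measurable (past n)"
proof -
  note w_past[measurable]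
  show ?thesis unfolding y_def by measurable
qed

lemma w_meas [measurable]: "w n \<in> borel_measurable P" and y_meas [measurable]: "y n \<in> borel_measurable P"
  using past_meas w_past y_past by blast+

lemma noise_measurable_past: "noise n \<in> borel_measurable (past (Suc n))"
proof -
  have [measurable]: "y n \<in> borel_measurable (past (Suc n))"
    by (rule measurable_from_subalg[OF past_Suc y_past])
  have [measurable]: "\<zeta> n \<in> measurable (past (Suc n)) S"
    by (rule coordinate_measurable_past_algebra) auto
  show ?thesis unfolding noise_def by measurable
qed

lemma noise_meas [measurable]: "noise n \<in> borel_measurable P"
  using past_meas noise_measurable_past by blast

lemma noise_le: "\<omega> \<in> space P \<Longrightarrow> norm (noise n \<omega>) \<le> 2 * L"
  unfolding noise_def
  using norm_triangle_ineq4[of "g (y n \<omega>) (\<zeta> n \<omega>)" "gbar (y n \<omega>)"] gbar_le[of "y n \<omega>"]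
    g_le[OF measurable_space[OF \<zeta>_meas], of \<omega> "y n \<omega>" n] by linarith

lemma D_0: "D 0 = norm (a2 - a1)" and D_Suc: "D (Suc n) = \<theta> * D n + (\<beta> n * L + e n)"
  by (simp_all add: D_def)

lemma e_nonneg: "0 \<le> e n" by (simp add: e_def)

lemma D_nonneg: "0 \<le> D n"
  using \<beta>(1) \<theta> L_nonneg e_nonneg by (induction n) (auto simp: D_0 D_Suc intro!: add_nonneg_nonneg)

lemma u_in: "u n \<omega> \<in> C" unfolding u_def by (rule closest_point_in_set[OF C(1) C_ne])

lemma norm_u_diff: "norm (u n \<omega> - w (Suc n) \<omega>) = e n"
proof (cases n)
  case 0 then show ?thesis by (simp add: u_def e_def w_def)
next
  case (Suc m)
  have "w (Suc n) \<omega> \<in> C" unfolding Suc w_Suc by (rule closest_point_in_set[OF C(1) C_ne])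
  then show ?thesis using Suc by (simp add: u_def e_def closest_point_self)
qed

text \<open>The new iterate is compared with \<open>u n\<close>, the projection of
  \<open>w (Suc n)\<close>, because projections are nonexpansive; the gap left between
  \<open>u n\<close> and \<open>w (Suc n)\<close> is \<open>e n\<close>.\<close>

lemma norm_w_diff: "\<omega> \<in> space P \<Longrightarrow> norm (w (Suc n) \<omega> - w n \<omega>) \<le> D n"
proof (induction n)
  case 0 show ?case by (simp add: w_def D_0)
next
  case (Suc n)
  have "norm (w (Suc (Suc n)) \<omega> - u n \<omega>) \<le> norm (y n \<omega> - \<beta> n *\<^sub>R g (y n \<omega>) (\<zeta> n \<omega>) - w (Suc n) \<omega>)"
    unfolding w_Suc u_def using closest_point_lipschitz[OF C(2,1) C_ne] by (simp add: dist_norm)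
  also have "\<dots> = norm (\<theta> *\<^sub>R (w (Suc n) \<omega> - w n \<omega>) - \<beta> n *\<^sub>R g (y n \<omega>) (\<zeta> n \<omega>))"
    by (simp add: y_def algebra_simps)
  also have "\<dots> \<le> \<theta> * norm (w (Suc n) \<omega> - w n \<omega>) + \<beta> n * norm (g (y n \<omega>) (\<zeta> n \<omega>))"
    using norm_triangle_ineq4 \<theta> \<beta>(1) by (metis abs_of_nonneg less_imp_le norm_scaleR)
  also have "\<dots> \<le> \<theta> * D n + \<beta> n * L"
    using Suc \<theta> \<beta>(1) g_le measurable_space[OF \<zeta>_meas Suc.prems]
    by (intro add_mono mult_left_mono) auto
  finally have "norm (w (Suc (Suc n)) \<omega> - u n \<omega>) \<le> \<theta> * D n + \<beta> n * L" .
  then show ?case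
    using norm_triangle_ineq[of "w (Suc (Suc n)) \<omega> - u n \<omega>" "u n \<omega> - w (Suc n) \<omega>"] norm_u_diff[of n \<omega>]
    by (simp add: D_Suc)
qed

lemma summable_e2: "summable (\<lambda>n. (e n)\<^sup>2)"
  by (rule summable_finite[of "{0}"]) (auto simp: e_def)

lemma summable_D2: "summable (\<lambda>n. (D n)\<^sup>2)"
proof (rule contraction_perturbed_square_summable)
  show "summable (\<lambda>n. (\<beta> n * L + e n)\<^sup>2)"
  proof (rule summable_comparison_test'[of "\<lambda>n. 2 * ((\<beta> n)\<^sup>2 * L\<^sup>2) + 2 * (e n)\<^sup>2" 0])
    show "summable (\<lambda>n. 2 * ((\<beta> n)\<^sup>2 * L\<^sup>2) + 2 * (e n)\<^sup>2)"
      using \<beta>(3) summable_e2 by (intro summable_add summable_mult summable_mult2)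
  qed (use square_add_le in \<open>auto simp flip: power_mult_distrib\<close>)
qed (use \<theta> D_nonneg D_Suc in auto)

lemma err_nonneg: "0 \<le> err n"
  unfolding err_def using \<theta> \<beta>(1) L_nonneg e_nonneg D_nonneg by (intro add_nonneg_nonneg mult_nonneg_nonneg) auto

text \<open>Only the mixed term needs work: \<open>2 * a * b \<le> a\<^sup>2 + b\<^sup>2\<close>
  separates step sizes from step lengths.\<close>

lemma summable_err: "summable err"
proof -
  have "summable (\<lambda>n. 2 * \<beta> n * (L * (e n + \<theta> * D n)))"
  proof (rule summable_comparison_test'[of "\<lambda>n. (\<beta> n)\<^sup>2 + L\<^sup>2 * (2 * (e n)\<^sup>2 + 2 * (\<theta>\<^sup>2 * (D n)\<^sup>2))" 0])
    show "summable (\<lambda>n. (\<beta> n)\<^sup>2 + L\<^sup>2 * (2 * (e n)\<^sup>2 + 2 * (\<theta>\<^sup>2 * (D n)\<^sup>2)))"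
      using \<beta>(3) summable_e2 summable_D2 by (intro summable_add summable_mult)
    fix n
    have "2 * \<beta> n * (L * (e n + \<theta> * D n)) \<le> (\<beta> n)\<^sup>2 + (L * (e n + \<theta> * D n))\<^sup>2"
      using sum_squares_bound[of "\<beta> n" "L * (e n + \<theta> * D n)"] by simp
    also have "(L * (e n + \<theta> * D n))\<^sup>2 \<le> L\<^sup>2 * (2 * (e n)\<^sup>2 + 2 * (\<theta> * D n)\<^sup>2)"
      unfolding power_mult_distrib[of L] by (intro mult_left_mono square_add_le) simp
    finally show "norm (2 * \<beta> n * (L * (e n + \<theta> * D n)))
        \<le> (\<beta> n)\<^sup>2 + L\<^sup>2 * (2 * (e n)\<^sup>2 + 2 * (\<theta>\<^sup>2 * (D n)\<^sup>2))"
      using \<theta> \<beta>(1)[of n] L_nonneg e_nonneg[of n] D_nonneg[of n] by (simp add: power_mult_distrib)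
  qed
  then show ?thesis
    unfolding err_def using \<beta>(3) summable_D2 by (intro summable_add summable_mult summable_mult2)
qed

text \<open>Projecting does not increase the distance to \<open>z\<close>, which lies in
  \<open>C\<close>. In the expanded square the inner product splits into a mean part, controlled by
  the subgradient inequality at \<open>y n\<close>, and a noise part.\<close>

lemma lyap_step:
  assumes \<omega>: "\<omega> \<in> space P" and z: "z \<in> C"
  shows "lyap z (Suc n) \<omega> \<le> lyap z n \<omega> - 2 * \<beta> n * (f (u n \<omega>) - f z) + err n
    - 2 * (\<beta> n * (noise n \<omega> \<bullet> (y n \<omega> - z)))"
proof -
  define G where "G = g (y n \<omega>) (\<zeta> n \<omega>)"
  define p where "p = w (Suc n) \<omega> - z"
  define q where "q = w n \<omega> - z"
  have dpq: "norm (p - q) \<le> D n" using norm_w_diff[OF \<omega>, of n] by (simp add: p_def q_def)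
  have yz: "y n \<omega> - z = (1 + \<theta>) *\<^sub>R p - \<theta> *\<^sub>R q"
    by (simp add: y_def p_def q_def algebra_simps)
  have G_le: "norm G \<le> L" unfolding G_def using g_le measurable_space[OF \<zeta>_meas \<omega>] by blast
  have "norm (w (Suc (Suc n)) \<omega> - z) \<le> norm (y n \<omega> - \<beta> n *\<^sub>R G - z)"
    unfolding w_Suc G_def
    using closest_point_lipschitz[OF C(2,1) C_ne, of _ z] z by (simp add: dist_norm closest_point_self)
  then have "(norm (w (Suc (Suc n)) \<omega> - z))\<^sup>2 \<le> (norm ((y n \<omega> - z) - \<beta> n *\<^sub>R G))\<^sup>2"
    by (intro power_mono) (auto simp: algebra_simps)
  also have "\<dots> = (norm (y n \<omega> - z))\<^sup>2 - 2 * (\<beta> n * (G \<bullet> (y n \<omega> - z))) + (\<beta> n)\<^sup>2 * (norm G)\<^sup>2"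
    unfolding power2_norm_eq_inner
    by (simp add: inner_diff_left inner_diff_right inner_commute power2_eq_square algebra_simps)
  also have "(norm (y n \<omega> - z))\<^sup>2
      = (1 + \<theta>) * (norm p)\<^sup>2 - \<theta> * (norm q)\<^sup>2 + \<theta> * (1 + \<theta>) * (norm (p - q))\<^sup>2"
    unfolding yz
    by (simp add: power2_norm_eq_inner inner_diff_left inner_diff_right inner_commute algebra_simps)
  also have "(norm (p - q))\<^sup>2 \<le> (D n)\<^sup>2" using dpq by (intro power_mono) auto
  also have "(norm G)\<^sup>2 \<le> L\<^sup>2" using G_le by (intro power_mono) auto
  finally have main: "(norm (w (Suc (Suc n)) \<omega> - z))\<^sup>2 \<le> (1 + \<theta>) * (norm p)\<^sup>2 - \<theta> * (norm q)\<^sup>2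
      + \<theta> * (1 + \<theta>) * (D n)\<^sup>2 - 2 * (\<beta> n * (G \<bullet> (y n \<omega> - z))) + (\<beta> n)\<^sup>2 * L\<^sup>2"
    using \<theta> by (simp add: mult_left_mono)
  \<comment> \<open>The extrapolated point may leave \<open>C\<close>, where \<open>f\<close> can
    fall below its minimum over \<open>C\<close>; hence the passage to the feasible
    \<open>u n \<omega>\<close>.\<close>
  have "norm (y n \<omega> - u n \<omega>) \<le> e n + \<theta> * D n"
  proof -
    have "y n \<omega> - u n \<omega> = \<theta> *\<^sub>R (p - q) - (u n \<omega> - w (Suc n) \<omega>)"
      by (simp add: y_def p_def q_def algebra_simps)
    then have "norm (y n \<omega> - u n \<omega>) \<le> norm (\<theta> *\<^sub>R (p - q)) + norm (u n \<omega> - w (Suc n) \<omega>)"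
      by (simp only: norm_triangle_ineq4)
    then have "norm (y n \<omega> - u n \<omega>) \<le> \<theta> * norm (p - q) + e n" using norm_u_diff[of n \<omega>] \<theta> by simp
    also have "\<theta> * norm (p - q) \<le> \<theta> * D n" using dpq \<theta> by (intro mult_left_mono) auto
    finally show ?thesis by simp
  qed
  then have "L * norm (y n \<omega> - u n \<omega>) \<le> L * (e n + \<theta> * D n)"
    using L_nonneg by (rule mult_left_mono)
  moreover have "gbar (y n \<omega>) \<bullet> (y n \<omega> - z) \<ge> f (y n \<omega>) - f z"
    using subgradient[of "y n \<omega>" z] by (simp add: gbar_def inner_diff_right)
  ultimately have "gbar (y n \<omega>) \<bullet> (y n \<omega> - z) \<ge> f (u n \<omega>) - f z - L * (e n + \<theta> * D n)"
    using f_lipschitz[of "y n \<omega>" "u n \<omega>"] by linarith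
  then have "\<beta> n * (gbar (y n \<omega>) \<bullet> (y n \<omega> - z))
      \<ge> \<beta> n * (f (u n \<omega>) - f z - L * (e n + \<theta> * D n))"
    using \<beta>(1) by (rule mult_left_mono)
  then have "\<beta> n * (gbar (y n \<omega>) \<bullet> (y n \<omega> - z))
      \<ge> \<beta> n * (f (u n \<omega>) - f z) - \<beta> n * (L * (e n + \<theta> * D n))"
    by (simp only: right_diff_distrib)
  moreover have "\<beta> n * (G \<bullet> (y n \<omega> - z))
      = \<beta> n * (gbar (y n \<omega>) \<bullet> (y n \<omega> - z)) + \<beta> n * (noise n \<omega> \<bullet> (y n \<omega> - z))"
    by (simp add: noise_def G_def inner_diff_left flip: distrib_left)
  moreover have "(1 + \<theta>) * (norm p)\<^sup>2 = (norm p)\<^sup>2 + \<theta> * (norm p)\<^sup>2" by (simp add: distrib_right)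
  ultimately show ?thesis
    using main unfolding lyap_def err_def mult.assoc[of 2] p_def[symmetric] q_def[symmetric] by linarith
qed

section \<open>Moment bounds and orthogonality of the noise\<close>

lemma w_bounded: "\<exists>B. \<forall>\<omega>\<in>space P. norm (w n \<omega>) \<le> B"
proof (induction n)
  case 0 show ?case by (auto simp: w_def)
next
  case (Suc n)
  then obtain B where B: "\<And>\<omega>. \<omega> \<in> space P \<Longrightarrow> norm (w n \<omega>) \<le> B" by blast
  have "norm (w (Suc n) \<omega>) \<le> B + D n" if "\<omega> \<in> space P" for \<omega>
    using B[OF that] norm_w_diff[OF that, of n] norm_triangle_ineq[of "w n \<omega>" "w (Suc n) \<omega> - w n \<omega>"]
    by simp
  then show ?case by blast
qed

lemma y_bounded: "\<exists>B. \<forall>\<omega>\<in>space P. norm (y n \<omega>) \<le> B"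
proof -
  obtain B1 B2 where "\<And>\<omega>. \<omega> \<in> space P \<Longrightarrow> norm (w n \<omega>) \<le> B1"
    and "\<And>\<omega>. \<omega> \<in> space P \<Longrightarrow> norm (w (Suc n) \<omega>) \<le> B2"
    using w_bounded by metis
  then have "norm (y n \<omega>) \<le> (1 + \<theta>) * B2 + \<theta> * B1" if "\<omega> \<in> space P" for \<omega>
    unfolding y_def using \<theta> that
    by (intro norm_triangle_le_diff) (auto intro!: add_mono mult_left_mono)
  then show ?thesis by blast
qed

lemma integrable_dist2: "integrable P (\<lambda>\<omega>. (norm (w n \<omega> - z))\<^sup>2)"
proof -
  obtain B where B: "\<And>\<omega>. \<omega> \<in> space P \<Longrightarrow> norm (w n \<omega>) \<le> B" using w_bounded by blast
  have "norm (w n \<omega> - z) \<le> B + norm z" if "\<omega> \<in> space P" for \<omega>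
    using norm_triangle_ineq4[of "w n \<omega>" z] B[OF that] by linarith
  then show ?thesis by (intro integrable_bounded[where B = "(B + norm z)\<^sup>2"]) (auto intro!: power_mono)
qed

lemma noise_inner_le:
  assumes "\<omega> \<in> space P" "norm v \<le> B"
  shows "\<bar>noise n \<omega> \<bullet> v\<bar> \<le> 2 * L * B"
proof -
  have "\<bar>noise n \<omega> \<bullet> v\<bar> \<le> norm (noise n \<omega>) * norm v" by (rule Cauchy_Schwarz_ineq2)
  also have "\<dots> \<le> 2 * L * B" using noise_le[OF assms(1)] assms(2) L_nonneg by (intro mult_mono) auto
  finally show ?thesis .
qed

lemma integrable_noise_inner:
  assumes [measurable]: "V \<in> borel_measurable P" and V: "\<And>\<omega>. \<omega> \<in> space P \<Longrightarrow> norm (V \<omega>) \<le> B"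
  shows "integrable P (\<lambda>\<omega>. noise n \<omega> \<bullet> V \<omega>)"
  using noise_inner_le V by (intro integrable_bounded[where B = "2 * L * B"]) auto

lemma noise_orthogonal:
  assumes V: "V \<in> borel_measurable (past n)" and B: "\<And>\<omega>. \<omega> \<in> space P \<Longrightarrow> norm (V \<omega>) \<le> B"
  shows "expectation (\<lambda>\<omega>. noise n \<omega> \<bullet> V \<omega>) = 0"
proof -
  interpret \<nu>: prob_space \<nu> by (rule prob_space_\<nu>)
  note [measurable] = V
  define h where "h = (\<lambda>p. (g (fst (fst p)) (snd p) - gbar (fst (fst p))) \<bullet> snd (fst p))"
  have h: "h \<in> borel_measurable ((borel \<Otimes>\<^sub>M borel) \<Otimes>\<^sub>M S)" unfolding h_def by measurable
  have Z: "(\<lambda>\<omega>. (y n \<omega>, V \<omega>)) \<in> measurable (past n) (borel \<Otimes>\<^sub>M borel)" by measurable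
  have int: "integrable P (\<lambda>\<omega>. h ((y n \<omega>, V \<omega>), \<zeta> n \<omega>))"
    using integrable_noise_inner[OF past_meas[OF V] B, of n] by (simp add: h_def noise_def)
  have zero: "(\<integral>s. h ((x, v), s) \<partial>distr P S (\<zeta> n)) = 0" for x v
  proof -
    have "(\<integral>s. h ((x, v), s) \<partial>\<nu>) = (\<integral>s. (g x s - gbar x) \<partial>\<nu>) \<bullet> v"
      unfolding h_def using integrable_g by (auto intro!: integral_inner_left)
    also have "(\<integral>s. (g x s - gbar x) \<partial>\<nu>) = 0"
      using integrable_g[of x] \<nu>.prob_space by (simp add: gbar_def)
    finally show ?thesis by (simp add: distr_\<zeta>)
  qed
  have "expectation (\<lambda>\<omega>. noise n \<omega> \<bullet> V \<omega>) = expectation (\<lambda>\<omega>. h ((y n \<omega>, V \<omega>), \<zeta> n \<omega>))"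
    by (simp add: h_def noise_def)
  also have "\<dots> = expectation (\<lambda>\<omega>. \<integral>s. h ((y n \<omega>, V \<omega>), s) \<partial>distr P S (\<zeta> n))"
    by (rule past_algebra_integral[OF indep Z h int])
  finally show ?thesis by (simp add: zero)
qed

text \<open>In expectation the noise term of \<open>lyap_step\<close> vanishes, the objective gap is
  nonnegative and the errors are summable, so the mean of \<open>lyap z0\<close> is bounded above.
  \<open>momentum_lyapunov_ge\<close> converts this into a bound on the squared distance.\<close>

lemma dist2_moment_bounded: "\<exists>Q. \<forall>n. expectation (\<lambda>\<omega>. (norm (w (Suc n) \<omega> - z0))\<^sup>2) \<le> Q"
proof -
  have int: "integrable P (lyap z0 n)" for n
    unfolding lyap_def using integrable_dist2 by simp
  have step: "expectation (lyap z0 (Suc n)) \<le> expectation (lyap z0 n) + err n" for n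
  proof -
    obtain B where B: "\<And>\<omega>. \<omega> \<in> space P \<Longrightarrow> norm (y n \<omega>) \<le> B" using y_bounded by blast
    have V: "(\<lambda>\<omega>. y n \<omega> - z0) \<in> borel_measurable (past n)" by measurable
    have VB: "norm (y n \<omega> - z0) \<le> B + norm z0" if "\<omega> \<in> space P" for \<omega>
      using norm_triangle_ineq4[of "y n \<omega>" z0] B[OF that] by linarith
    have iV: "integrable P (\<lambda>\<omega>. noise n \<omega> \<bullet> (y n \<omega> - z0))"
      using integrable_noise_inner[OF past_meas[OF V] VB] .
    have "expectation (lyap z0 (Suc n))
        \<le> expectation (\<lambda>\<omega>. lyap z0 n \<omega> + err n - 2 * (\<beta> n * (noise n \<omega> \<bullet> (y n \<omega> - z0))))"
    proof (rule integral_mono[OF int])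
      show "integrable P (\<lambda>\<omega>. lyap z0 n \<omega> + err n - 2 * (\<beta> n * (noise n \<omega> \<bullet> (y n \<omega> - z0))))"
        using int iV by simp
      fix \<omega> assume \<omega>: "\<omega> \<in> space P"
      have "0 \<le> 2 * \<beta> n * (f (u n \<omega>) - f z0)" using \<beta>(1) optimal(2)[OF u_in] by simp
      then show "lyap z0 (Suc n) \<omega> \<le> lyap z0 n \<omega> + err n - 2 * (\<beta> n * (noise n \<omega> \<bullet> (y n \<omega> - z0)))"
        using lyap_step[OF \<omega> optimal(1), of n] by linarith
    qed
    also have "\<dots> = expectation (lyap z0 n) + err n"
      using int iV noise_orthogonal[OF V VB] prob_space by simp
    finally show ?thesis .
  qed
  define E where "E = expectation (lyap z0 0) + suminf err"
  have E: "expectation (lyap z0 n) \<le> E" for n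
  proof -
    have "expectation (lyap z0 n) \<le> expectation (lyap z0 0) + (\<Sum>i<n. err i)"
    proof (induction n)
      case (Suc n) then show ?case using step[of n] by simp
    qed simp
    also have "(\<Sum>i<n. err i) \<le> suminf err" using summable_err err_nonneg by (intro sum_le_suminf) auto
    finally show ?thesis by (simp add: E_def)
  qed
  define K where "K = \<theta> * (1 + \<theta>) / (1 - \<theta>)"
  have "expectation (\<lambda>\<omega>. (norm (w (Suc n) \<omega> - z0))\<^sup>2) \<le> (E + K * (\<Sum>i. (D i)\<^sup>2)) / ((1 - \<theta>) / 2)" for n
  proof -
    have "(D n)\<^sup>2 \<le> (\<Sum>i. (D i)\<^sup>2)" using sum_le_suminf[OF summable_D2, of "{n}"] by simp
    then have KD: "K * (D n)\<^sup>2 \<le> K * (\<Sum>i. (D i)\<^sup>2)" using \<theta> by (intro mult_left_mono) (auto simp: K_def)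
    have "expectation (\<lambda>\<omega>. (1 - \<theta>) / 2 * (norm (w (Suc n) \<omega> - z0))\<^sup>2 - K * (D n)\<^sup>2)
        \<le> expectation (lyap z0 n)"
    proof (rule integral_mono[OF _ int])
      show "integrable P (\<lambda>\<omega>. (1 - \<theta>) / 2 * (norm (w (Suc n) \<omega> - z0))\<^sup>2 - K * (D n)\<^sup>2)"
        using integrable_dist2 by simp
      show "(1 - \<theta>) / 2 * (norm (w (Suc n) \<omega> - z0))\<^sup>2 - K * (D n)\<^sup>2 \<le> lyap z0 n \<omega>"
        if "\<omega> \<in> space P" for \<omega>
        unfolding lyap_def K_def using momentum_lyapunov_ge[OF \<theta> norm_w_diff[OF that]] .
    qed
    then have "(1 - \<theta>) / 2 * expectation (\<lambda>\<omega>. (norm (w (Suc n) \<omega> - z0))\<^sup>2) - K * (D n)\<^sup>2 \<le> E"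
      using E[of n] integrable_dist2 prob_space by simp
    then have "expectation (\<lambda>\<omega>. (norm (w (Suc n) \<omega> - z0))\<^sup>2) * ((1 - \<theta>) / 2) \<le> E + K * (\<Sum>i. (D i)\<^sup>2)"
      using KD by (simp add: mult.commute)
    then show ?thesis using \<theta> by (subst pos_le_divide_eq) auto
  qed
  then show ?thesis by blast
qed

lemma y_moment_bounded: "\<exists>Q. \<forall>n. expectation (\<lambda>\<omega>. (norm (y n \<omega>))\<^sup>2) \<le> Q"
proof -
  obtain Q where Q: "\<And>n. expectation (\<lambda>\<omega>. (norm (w (Suc n) \<omega> - z0))\<^sup>2) \<le> Q"
    using dist2_moment_bounded by blast
  \<comment> \<open>The factors 4 come from applying \<open>square_add_le\<close> twice to a sum of
    three terms.\<close>
  define R where "R = 4 * (\<Sum>i. (D i)\<^sup>2) + 4 * (norm z0)\<^sup>2"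
  have ptw: "(norm (y n \<omega>))\<^sup>2 \<le> 2 * (norm (w (Suc n) \<omega> - z0))\<^sup>2 + R" if \<omega>: "\<omega> \<in> space P" for n \<omega>
  proof -
    have "norm (\<theta> *\<^sub>R (w (Suc n) \<omega> - w n \<omega>)) \<le> D n"
      using \<theta> norm_w_diff[OF \<omega>, of n]
        mult_left_le_one_le[of "norm (w (Suc n) \<omega> - w n \<omega>)" \<theta>] by simp
    moreover have "norm (y n \<omega>) = norm ((w (Suc n) \<omega> - z0) + (\<theta> *\<^sub>R (w (Suc n) \<omega> - w n \<omega>) + z0))"
      by (simp add: y_def algebra_simps)
    ultimately have "norm (y n \<omega>) \<le> norm (w (Suc n) \<omega> - z0) + (D n + norm z0)"
      using norm_triangle_ineq[of "w (Suc n) \<omega> - z0" "\<theta> *\<^sub>R (w (Suc n) \<omega> - w n \<omega>) + z0"]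
        norm_triangle_ineq[of "\<theta> *\<^sub>R (w (Suc n) \<omega> - w n \<omega>)" z0] by linarith
    then have "(norm (y n \<omega>))\<^sup>2 \<le> (norm (w (Suc n) \<omega> - z0) + (D n + norm z0))\<^sup>2"
      by (intro power_mono) auto
    also have "\<dots> \<le> 2 * (norm (w (Suc n) \<omega> - z0))\<^sup>2 + 2 * (D n + norm z0)\<^sup>2" by (rule square_add_le)
    also have "(D n + norm z0)\<^sup>2 \<le> 2 * (D n)\<^sup>2 + 2 * (norm z0)\<^sup>2" by (rule square_add_le)
    also have "(D n)\<^sup>2 \<le> (\<Sum>i. (D i)\<^sup>2)" using sum_le_suminf[OF summable_D2, of "{n}"] by simp
    finally show ?thesis by (simp add: R_def)
  qed
  have "expectation (\<lambda>\<omega>. (norm (y n \<omega>))\<^sup>2) \<le> 2 * Q + R" for n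
  proof -
    have i: "integrable P (\<lambda>\<omega>. 2 * (norm (w (Suc n) \<omega> - z0))\<^sup>2 + R)" using integrable_dist2 by simp
    obtain B where B: "\<And>\<omega>. \<omega> \<in> space P \<Longrightarrow> norm (y n \<omega>) \<le> B" using y_bounded by blast
    have "integrable P (\<lambda>\<omega>. (norm (y n \<omega>))\<^sup>2)"
      using B by (intro integrable_bounded[where B = "B\<^sup>2"]) (auto intro!: power_mono)
    then have "expectation (\<lambda>\<omega>. (norm (y n \<omega>))\<^sup>2)
        \<le> expectation (\<lambda>\<omega>. 2 * (norm (w (Suc n) \<omega> - z0))\<^sup>2 + R)"
      using i ptw by (rule integral_mono)
    also have "\<dots> = 2 * expectation (\<lambda>\<omega>. (norm (w (Suc n) \<omega> - z0))\<^sup>2) + R"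
      using integrable_dist2 prob_space by simp
    finally show ?thesis using Q[of n] by linarith
  qed
  then show ?thesis by blast
qed

section \<open>Almost sure convergence of the noise series and of the iterates\<close>

text \<open>The noise has norm at most \<open>2 * L\<close>, which yields the variance bound
  \<open>(\<beta> n)\<^sup>2 * (4 * L\<^sup>2 * Q)\<close>. A general \<open>V\<close> serves both
  the query points and the constant basis vectors.\<close>

lemma noise_series_summable:
  assumes V: "\<And>n. V n \<in> borel_measurable (past n)"
    and bnd: "\<And>n. \<exists>B. \<forall>\<omega>\<in>space P. norm (V n \<omega>) \<le> B"
    and Q: "\<And>n. expectation (\<lambda>\<omega>. (norm (V n \<omega>))\<^sup>2) \<le> Q"
  shows "AE \<omega> in P. summable (\<lambda>n. \<beta> n * (noise n \<omega> \<bullet> V n \<omega>))"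
proof (rule martingale_differences_summable[where F = past, OF sub_past past_Suc])
  have [measurable]: "V n \<in> borel_measurable P" for n using past_meas[OF V] .
  have i2: "integrable P (\<lambda>\<omega>. (\<beta> n * (noise n \<omega> \<bullet> V n \<omega>))\<^sup>2)
      \<and> integrable P (\<lambda>\<omega>. (norm (V n \<omega>))\<^sup>2)" for n
  proof -
    obtain B where B: "\<And>\<omega>. \<omega> \<in> space P \<Longrightarrow> norm (V n \<omega>) \<le> B" using bnd by blast
    have "\<bar>\<beta> n * (noise n \<omega> \<bullet> V n \<omega>)\<bar> \<le> \<beta> n * (2 * L * B)" if "\<omega> \<in> space P" for \<omega>
      using noise_inner_le[OF that B[OF that]] \<beta>(1) by (simp add: abs_mult mult_left_mono)
    then have "\<bar>(\<beta> n * (noise n \<omega> \<bullet> V n \<omega>))\<^sup>2\<bar> \<le> (\<beta> n * (2 * L * B))\<^sup>2" if "\<omega> \<in> space P" for \<omega>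
      using power_mono[of "\<bar>\<beta> n * (noise n \<omega> \<bullet> V n \<omega>)\<bar>" _ 2] that by simp
    then have "integrable P (\<lambda>\<omega>. (\<beta> n * (noise n \<omega> \<bullet> V n \<omega>))\<^sup>2)"
      by (intro integrable_bounded[where B = "(\<beta> n * (2 * L * B))\<^sup>2"]) auto
    moreover have "integrable P (\<lambda>\<omega>. (norm (V n \<omega>))\<^sup>2)"
      using B by (intro integrable_bounded[where B = "B\<^sup>2"]) (auto intro!: power_mono)
    ultimately show ?thesis ..
  qed
  show "integrable P (\<lambda>\<omega>. (\<beta> n * (noise n \<omega> \<bullet> V n \<omega>))\<^sup>2)" for n using i2 by blast
  show "(\<lambda>\<omega>. \<beta> n * (noise n \<omega> \<bullet> V n \<omega>)) \<in> borel_measurable (past (Suc n))" for n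
  proof -
    note noise_measurable_past[measurable]
    have [measurable]: "V n \<in> borel_measurable (past (Suc n))"
      by (rule measurable_from_subalg[OF past_Suc V])
    show ?thesis by measurable
  qed
  show "summable (\<lambda>n. expectation (\<lambda>\<omega>. (\<beta> n * (noise n \<omega> \<bullet> V n \<omega>))\<^sup>2))"
  proof (rule summable_comparison_test'[of "\<lambda>n. (\<beta> n)\<^sup>2 * (4 * L\<^sup>2 * Q)" 0])
    show "summable (\<lambda>n. (\<beta> n)\<^sup>2 * (4 * L\<^sup>2 * Q))" using \<beta>(3) by (rule summable_mult2)
    fix n
    have "expectation (\<lambda>\<omega>. (\<beta> n * (noise n \<omega> \<bullet> V n \<omega>))\<^sup>2)
        \<le> expectation (\<lambda>\<omega>. (\<beta> n)\<^sup>2 * (4 * L\<^sup>2) * (norm (V n \<omega>))\<^sup>2)"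
    proof (rule integral_mono)
      fix \<omega> assume "\<omega> \<in> space P"
      then have "\<bar>noise n \<omega> \<bullet> V n \<omega>\<bar> \<le> 2 * L * norm (V n \<omega>)" using noise_inner_le by blast
      then have "(noise n \<omega> \<bullet> V n \<omega>)\<^sup>2 \<le> (2 * L * norm (V n \<omega>))\<^sup>2"
        using power_mono[of "\<bar>noise n \<omega> \<bullet> V n \<omega>\<bar>" _ 2] by simp
      then show "(\<beta> n * (noise n \<omega> \<bullet> V n \<omega>))\<^sup>2 \<le> (\<beta> n)\<^sup>2 * (4 * L\<^sup>2) * (norm (V n \<omega>))\<^sup>2"
        by (simp add: power_mult_distrib mult_left_mono mult.assoc)
    qed (use i2 in auto)
    also have "\<dots> = (\<beta> n)\<^sup>2 * (4 * L\<^sup>2) * expectation (\<lambda>\<omega>. (norm (V n \<omega>))\<^sup>2)" by simp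
    also have "\<dots> \<le> (\<beta> n)\<^sup>2 * (4 * L\<^sup>2) * Q" using Q by (intro mult_left_mono) auto
    finally show "norm (expectation (\<lambda>\<omega>. (\<beta> n * (noise n \<omega> \<bullet> V n \<omega>))\<^sup>2)) \<le> (\<beta> n)\<^sup>2 * (4 * L\<^sup>2 * Q)"
      by (simp add: mult.assoc)
  qed
  fix n \<phi> and B :: real assume \<phi>: "\<phi> \<in> borel_measurable (past n)" "\<And>\<omega>. \<bar>\<phi> \<omega>\<bar> \<le> B"
  obtain B' where B': "\<And>\<omega>. \<omega> \<in> space P \<Longrightarrow> norm (V n \<omega>) \<le> B'" using bnd by blast
  \<comment> \<open>The test function and the step size are absorbed into the past-measurable
    vector.\<close>
  have "expectation (\<lambda>\<omega>. noise n \<omega> \<bullet> ((\<beta> n * \<phi> \<omega>) *\<^sub>R V n \<omega>)) = 0"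
  proof (rule noise_orthogonal)
    show "(\<lambda>\<omega>. (\<beta> n * \<phi> \<omega>) *\<^sub>R V n \<omega>) \<in> borel_measurable (past n)"
      using \<phi>(1) V by measurable
    show "norm ((\<beta> n * \<phi> \<omega>) *\<^sub>R V n \<omega>) \<le> \<beta> n * B * B'" if "\<omega> \<in> space P" for \<omega>
      using \<phi>(2)[of \<omega>] B'[OF that] \<beta>(1)[of n] by (auto simp: abs_mult intro!: mult_mono mult_nonneg_nonneg)
  qed
  then show "expectation (\<lambda>\<omega>. \<phi> \<omega> * (\<beta> n * (noise n \<omega> \<bullet> V n \<omega>))) = 0" by (simp add: mult_ac)
qed

theorem AE_converges_to_minimizer:
  "AE \<omega> in P. \<exists>z. z \<in> C \<and> (\<forall>x\<in>C. f z \<le> f x) \<and> (\<lambda>n. w n \<omega>) \<longlonglongrightarrow> z"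
proof -
  obtain Q where "\<And>n. expectation (\<lambda>\<omega>. (norm (y n \<omega>))\<^sup>2) \<le> Q" using y_moment_bounded by blast
  then have "AE \<omega> in P. summable (\<lambda>n. \<beta> n * (noise n \<omega> \<bullet> y n \<omega>))"
    using y_bounded by (intro noise_series_summable) auto
  moreover have "AE \<omega> in P. \<forall>b\<in>Basis. summable (\<lambda>n. \<beta> n * (noise n \<omega> \<bullet> b))"
  proof (rule AE_finite_allI)
    fix b :: 'a
    show "AE \<omega> in P. summable (\<lambda>n. \<beta> n * (noise n \<omega> \<bullet> b))"
      by (rule noise_series_summable[where Q = "(norm b)\<^sup>2"]) (auto simp: prob_space)
  qed simp
  ultimately show ?thesis using AE_space
  proof eventually_elim
    case (elim \<omega>)
    show ?case
    proof (rule lyapunov_momentum_convergence[OF \<theta> norm_w_diff[OF elim(3)] summable_D2 C(1) u_in[of _ \<omega>] _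
          \<beta>(1,2) continuous_f optimal])
      have "e \<longlonglongrightarrow> 0"
        by (rule tendsto_eventually) (auto simp: e_def eventually_sequentially intro!: exI[of _ 1])
      then have "(\<lambda>n. norm (u n \<omega> - w (Suc n) \<omega>)) \<longlonglongrightarrow> 0" by (simp add: norm_u_diff)
      then show "(\<lambda>n. u n \<omega> - w (Suc n) \<omega>) \<longlonglongrightarrow> 0" by (rule tendsto_norm_zero_cancel)
      fix z assume z: "z \<in> C"
      txt \<open>Expanding \<^term>\<open>z\<close> in the basis lets one null set serve every minimizer.\<close>
      have "noise n \<omega> \<bullet> (y n \<omega> - z) = noise n \<omega> \<bullet> y n \<omega> - (\<Sum>b\<in>Basis. (z \<bullet> b) * (noise n \<omega> \<bullet> b))" for n
        by (simp add: inner_diff_right euclidean_inner[of "noise n \<omega>" z] mult.commute)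
      then have eq: "\<beta> n * (noise n \<omega> \<bullet> (y n \<omega> - z))
          = \<beta> n * (noise n \<omega> \<bullet> y n \<omega>) - (\<Sum>b\<in>Basis. (z \<bullet> b) * (\<beta> n * (noise n \<omega> \<bullet> b)))" for n
        by (simp add: right_diff_distrib sum_distrib_left mult_ac)
      have "summable (\<lambda>n. \<beta> n * (noise n \<omega> \<bullet> (y n \<omega> - z)))"
        unfolding eq using elim by (intro summable_diff summable_sum summable_mult) auto
      then have "summable (\<lambda>n. err n - 2 * (\<beta> n * (noise n \<omega> \<bullet> (y n \<omega> - z))))"
        by (intro summable_diff summable_err summable_mult)
      then show "\<exists>e. summable e \<and> (\<forall>n. (norm (w (Suc (Suc n)) \<omega> - z))\<^sup>2 - \<theta> * (norm (w (Suc n) \<omega> - z))\<^sup>2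
          \<le> (norm (w (Suc n) \<omega> - z))\<^sup>2 - \<theta> * (norm (w n \<omega> - z))\<^sup>2 - 2 * \<beta> n * (f (u n \<omega>) - f z) + e n)"
        using lyap_step[OF elim(3) z] unfolding lyap_def by (intro exI conjI allI) (auto simp: algebra_simps)
    qed
  qed
qed

end

section \<open>Reduction of the almost sure hypotheses to sure ones\<close>

text \<open>As \<open>C\<close> may be unbounded, existence of an optimal solution is a hypothesis.
  When there are several, the limit can vary with the sample path, hence a random variable
  \<open>X\<close>.\<close>

theorem theorem14:
  fixes P :: "'w measure" and \<Xi> :: "'s measure"
    and \<xi> :: "'w \<Rightarrow> 's" and \<xi>s :: "nat \<Rightarrow> 'w \<Rightarrow> 's"
    and F :: "real ^ 'n \<Rightarrow> 's \<Rightarrow> real" and g :: "real ^ 'n \<Rightarrow> 's \<Rightarrow> real ^ 'n"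
    and C :: "(real ^ 'n) set"
    and \<alpha> :: "nat \<Rightarrow> real" and \<theta> M :: real and a1 a2 :: "real ^ 'n"
    and x v :: "nat \<Rightarrow> 'w \<Rightarrow> real ^ 'n"
  assumes P: "prob_space P"
    and \<xi>: "\<xi> \<in> measurable P \<Xi>"
    and samples_indep: "prob_space.indep_vars P (\<lambda>_. \<Xi>) \<xi>s {1..}"
    and samples_distr: "\<And>k. k \<ge> 1 \<Longrightarrow> distr P \<Xi> (\<xi>s k) = distr P \<Xi> \<xi>"
    and F_meas: "\<And>y. F y \<in> borel_measurable \<Xi>"
    and F_integrable: "\<And>y. integrable P (\<lambda>\<omega>. F y (\<xi> \<omega>))"
    and g_meas: "(\<lambda>(y, s). g y s) \<in> borel_measurable (borel \<Otimes>\<^sub>M \<Xi>)"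
    and C: "C \<noteq> {}" "closed C" "convex C"
    and solvable: "\<exists>z. optimal_solution (expected_objective P \<xi> F) C z"
    and \<theta>: "0 < \<theta>" "\<theta> < 1"
    and iterates: "\<And>\<omega>. \<omega> \<in> space P \<Longrightarrow>
          nesterov_subgradient_iterates C g \<alpha> \<theta> a1 a2 (\<lambda>k. \<xi>s k \<omega>) (\<lambda>k. x k \<omega>) (\<lambda>k. v k \<omega>)"
    and a: "AE s in distr P \<Xi> \<xi>.
          continuous_on UNIV (\<lambda>y. F y s) \<and> convex_on UNIV (\<lambda>y. F y s)"
    and b: "AE s in distr P \<Xi> \<xi>. \<forall>y. g y s \<in> subdifferential (\<lambda>y. F y s) y"
    and c: "\<And>k. k \<ge> 1 \<Longrightarrow> \<alpha> k \<ge> 0"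
           "filterlim (\<lambda>n. \<Sum>k=1..n. \<alpha> k) at_top sequentially"
           "summable (\<lambda>k. (\<alpha> (Suc k))\<^sup>2)"
    and d: "AE s in distr P \<Xi> \<xi>. \<forall>y. \<forall>u \<in> subdifferential (\<lambda>y. F y s) y. norm u \<le> M"
  shows "\<exists>X \<in> borel_measurable P. AE \<omega> in P.
           optimal_solution (expected_objective P \<xi> F) C (X \<omega>) \<and>
           (\<lambda>k. x k \<omega>) \<longlonglongrightarrow> X \<omega> \<and> (\<lambda>k. v k \<omega>) \<longlonglongrightarrow> X \<omega>"
proof -
  interpret P: prob_space P by (rule P)
  define \<nu> where "\<nu> = distr P \<Xi> \<xi>"
  interpret \<nu>: prob_space \<nu> unfolding \<nu>_def using \<xi> by (rule P.prob_space_distr)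
  have sp_\<nu> [simp]: "space \<nu> = space \<Xi>" and sets_\<nu> [measurable_cong]: "sets \<nu> = sets \<Xi>"
    by (simp_all add: \<nu>_def)
  define f where "f = expected_objective P \<xi> F"
  obtain z0 where z0: "optimal_solution f C z0" using solvable unfolding f_def by blast
  have opt_iff: "optimal_solution f C z \<longleftrightarrow> z \<in> C \<and> (\<forall>y\<in>C. f z \<le> f y)" for z
    by (auto simp: optimal_solution_def is_arg_min_linorder)
  define good where "good s \<longleftrightarrow> (\<forall>y. g y s \<in> subdifferential (\<lambda>y. F y s) y)
      \<and> (\<forall>y. \<forall>u \<in> subdifferential (\<lambda>y. F y s) y. norm u \<le> M)" for s
  have "AE s in \<nu>. good s" using b d unfolding \<nu>_def[symmetric] good_def by eventually_elim blast
  \<comment> \<open>The set of bad samples need not be measurable, so it is enlarged to a measurable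
    null set.\<close>
  then obtain N where N_sub: "{s \<in> space \<nu>. \<not> good s} \<subseteq> N"
    and N0: "emeasure \<nu> N = 0" "N \<in> sets \<nu>"
    by (rule AE_E)
  have N_meas [measurable]: "N \<in> sets \<Xi>" using N0(2) sets_\<nu> by simp
  have good: "good s" if "s \<in> space \<Xi> - N" for s using N_sub that by auto
  have AE_N: "AE s in \<nu>. s \<notin> N" using N0 by (intro AE_not_in null_setsI)
  have sub: "F y s + g y s \<bullet> (y' - y) \<le> F y' s" and g_le: "norm (g y s) \<le> M"
    if "s \<in> space \<Xi> - N" for y y' s
    using good[OF that] unfolding good_def subdifferential_def by blast+
  \<comment> \<open>Some sample lies outside \<open>N\<close>, which forces \<open>M\<close> to be
    nonnegative; the value 0 assigned on \<open>N\<close> below then obeys the bound too.\<close>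
  have "space \<Xi> - N \<noteq> {}"
  proof
    assume "space \<Xi> - N = {}"
    then have "N = space \<nu>" using sets.sets_into_space[OF N0(2)] by auto
    then show False using N0(1) \<nu>.emeasure_space_1 by (metis zero_neq_one)
  qed
  then have M: "0 \<le> M" using g_le norm_ge_zero order_trans by (metis ex_in_conv)
  text \<open>Discarding the exceptional null set of samples makes every bound hold surely.\<close>
  define g' where "g' y s = (if s \<in> space \<Xi> - N then g y s else 0)" for y s
  have g'_meas: "(\<lambda>(y, s). g' y s) \<in> borel_measurable (borel \<Otimes>\<^sub>M \<Xi>)"
  proof -
    have "(\<lambda>p. if snd p \<in> space \<Xi> - N then g (fst p) (snd p) else 0) \<in> borel_measurable (borel \<Otimes>\<^sub>M \<Xi>)"
      using g_meas[unfolded case_prod_unfold] by measurable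
    then show ?thesis by (simp add: g'_def case_prod_unfold)
  qed
  have g'_le: "norm (g' y s) \<le> M" for y s using g_le M by (simp add: g'_def)
  have g'_int: "integrable \<nu> (g' y)" for y
  proof (rule \<nu>.integrable_const_bound[of _ M])
    have "(\<lambda>s. (y, s)) \<in> measurable \<Xi> (borel \<Otimes>\<^sub>M \<Xi>)" by measurable
    from measurable_compose[OF this g'_meas] show "g' y \<in> borel_measurable \<nu>"
      by (simp add: measurable_cong_sets[OF sets_\<nu> refl])
  qed (simp add: g'_le)
  have F_int: "integrable \<nu> (F y)" for y
    unfolding \<nu>_def using F_integrable integrable_distr_eq[OF \<xi> F_meas] by blast
  have f_eq: "f y = (\<integral>s. F y s \<partial>\<nu>)" for y
    unfolding f_def expected_objective_def \<nu>_def by (rule integral_distr[OF \<xi> F_meas, symmetric])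
  \<comment> \<open>On \<open>N\<close> the value 0 need not be a subgradient, so the inequality is
    integrated almost everywhere.\<close>
  have f_sub: "f y + (\<integral>s. g' y s \<partial>\<nu>) \<bullet> (y' - y) \<le> f y'" for y y'
  proof -
    have "f y + (\<integral>s. g' y s \<partial>\<nu>) \<bullet> (y' - y) = (\<integral>s. F y s + g' y s \<bullet> (y' - y) \<partial>\<nu>)"
      using F_int g'_int by (simp add: f_eq)
    also have "\<dots> \<le> (\<integral>s. F y' s \<partial>\<nu>)"
    proof (rule integral_mono_AE)
      show "AE s in \<nu>. F y s + g' y s \<bullet> (y' - y) \<le> F y' s"
        using AE_N AE_space by eventually_elim (auto simp: g'_def intro: sub)
    qed (use F_int g'_int in auto)
    finally show ?thesis by (simp add: f_eq)
  qed
  \<comment> \<open>The first update computes \<open>v 3\<close>, with step size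
    \<open>\<alpha> 2\<close> and sample \<open>\<xi>s 3\<close>.\<close>
  define \<zeta> where "\<zeta> n = \<xi>s (n + 3)" for n
  define \<beta> where "\<beta> n = \<alpha> (n + 2)" for n
  have \<beta>_div: "\<not> summable \<beta>"
  proof
    assume "summable \<beta>"
    then have "summable (\<lambda>n. \<alpha> (Suc n))"
      unfolding \<beta>_def using summable_iff_shift[of "\<lambda>n. \<alpha> (Suc n)" 1] by simp
    then have "convergent (\<lambda>n. \<Sum>i<n. \<alpha> (Suc i))" by (simp add: summable_iff_convergent)
    moreover have "(\<Sum>i<n. \<alpha> (Suc i)) = (\<Sum>k=1..n. \<alpha> k)" for n
      by (rule sum.reindex_bij_witness[of _ "\<lambda>k. k - 1" Suc]) auto
    ultimately have "convergent (\<lambda>n. \<Sum>k=1..n. \<alpha> k)" by simp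
    then show False using c(2) not_tendsto_and_filterlim_at_infinity[OF _ _ filterlim_at_top_imp_at_infinity]
      unfolding convergent_def by (metis sequentially_bot)
  qed
  interpret sm: stochastic_momentum P \<Xi> \<nu> \<zeta> g' f C \<beta> \<theta> M a1 a2 z0
  proof
    have "P.indep_vars (\<lambda>_. \<Xi>) (\<lambda>n. \<xi>s (n + 3)) UNIV"
      by (rule P.indep_vars_reindex) (auto intro: inj_onI P.indep_vars_subset[OF samples_indep])
    then show "P.indep_vars (\<lambda>_. \<Xi>) \<zeta> UNIV" by (simp add: \<zeta>_def[abs_def])
    show "distr P \<Xi> (\<zeta> n) = \<nu>" for n using samples_distr by (simp add: \<zeta>_def \<nu>_def)
    show "summable (\<lambda>n. (\<beta> n)\<^sup>2)"
      unfolding \<beta>_def using c(3) summable_iff_shift[of "\<lambda>n. (\<alpha> (Suc n))\<^sup>2" 1] by simp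
  qed (use g'_meas g'_le f_sub C z0 opt_iff c(1) \<beta>_div \<theta> in \<open>auto simp: \<beta>_def\<close>)
  have "AE \<omega> in P. \<zeta> n \<omega> \<notin> N" for n
  proof (rule AE_distrD[where f = "\<zeta> n" and P = "\<lambda>s. s \<notin> N"])
    show "AE s in distr P \<Xi> (\<zeta> n). s \<notin> N" unfolding sm.distr_\<zeta> by (rule AE_N)
  qed simp
  \<comment> \<open>Almost every path never meets \<open>N\<close>; along it the modified and the
    given subgradients agree at every update.\<close>
  then have AE_\<zeta>: "AE \<omega> in P. \<forall>n. \<zeta> n \<omega> \<notin> N" by (simp add: AE_all_countable)
  \<comment> \<open>\<open>lim\<close> yields a function that is measurable on the whole space,
    including the paths without convergence.\<close>
  define X where "X \<omega> = lim (\<lambda>n. sm.w n \<omega>)" for \<omega>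
  have "X \<in> borel_measurable P" unfolding X_def by measurable
  moreover have "AE \<omega> in P. optimal_solution f C (X \<omega>) \<and>
      (\<lambda>k. x k \<omega>) \<longlonglongrightarrow> X \<omega> \<and> (\<lambda>k. v k \<omega>) \<longlonglongrightarrow> X \<omega>"
    using sm.AE_converges_to_minimizer AE_\<zeta> AE_space
  proof eventually_elim
    case (elim \<omega>)
    then obtain z where z: "optimal_solution f C z" "(\<lambda>n. sm.w n \<omega>) \<longlonglongrightarrow> z" using opt_iff by blast
    have Xz: "X \<omega> = z" unfolding X_def using z(2) by (rule limI)
    have it: "v 1 \<omega> = a1" "v 2 \<omega> = a2"
      "x (k + 1) \<omega> = (1 + \<theta>) *\<^sub>R v k \<omega> - \<theta> *\<^sub>R v (k - 1) \<omega>"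
      "v (k + 1) \<omega> = closest_point C (x (k + 1) \<omega> - \<alpha> k *\<^sub>R g (x (k + 1) \<omega>) (\<xi>s (k + 1) \<omega>))"
      if "k \<ge> 2" for k
      using iterates[OF elim(3)] that by (auto simp: nesterov_subgradient_iterates_def)
    have g'_eq: "g' p (\<zeta> n \<omega>) = g p (\<zeta> n \<omega>)" for p n
      using elim(2) measurable_space[OF sm.\<zeta>_meas elim(3), of n] by (simp add: g'_def)
    \<comment> \<open>Two consecutive indices are carried along because the recursion looks back two
      steps.\<close>
    have "v (n + 1) \<omega> = sm.w n \<omega> \<and> v (n + 2) \<omega> = sm.w (Suc n) \<omega>" for n
    proof (induction n)
      case 0 show ?case using it(1,2)[of 2] by (simp add: sm.w_def numeral_2_eq_2)
    next
      case (Suc n)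
      have "x (n + 3) \<omega> = sm.y n \<omega>" using it(3)[of "n + 2"] Suc by (simp add: sm.y_def numeral_eq_Suc)
      then show ?case
        using it(4)[of "n + 2"] Suc sm.w_Suc[of n \<omega>] unfolding g'_eq by (simp add: \<beta>_def[of n] \<zeta>_def[of n] numeral_eq_Suc)
    qed
    then have vw: "v (n + 1) \<omega> = sm.w n \<omega>" for n by blast
    then have v_lim: "(\<lambda>n. v (n + 1) \<omega>) \<longlonglongrightarrow> z" using z(2) by simp
    have "(\<lambda>n. (1 + \<theta>) *\<^sub>R v (Suc n + 1) \<omega> - \<theta> *\<^sub>R v (n + 1) \<omega>) \<longlonglongrightarrow> (1 + \<theta>) *\<^sub>R z - \<theta> *\<^sub>R z"
      using v_lim LIMSEQ_Suc[OF v_lim] by (intro tendsto_intros)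
    moreover have "(1 + \<theta>) *\<^sub>R v (Suc n + 1) \<omega> - \<theta> *\<^sub>R v (n + 1) \<omega> = x (n + 3) \<omega>" for n
      using it(3)[of "n + 2"] by (simp add: numeral_eq_Suc)
    ultimately have "(\<lambda>n. x (n + 3) \<omega>) \<longlonglongrightarrow> z" by (simp add: algebra_simps)
    then have "(\<lambda>k. x k \<omega>) \<longlonglongrightarrow> z" by (rule LIMSEQ_offset)
    moreover have "(\<lambda>k. v k \<omega>) \<longlonglongrightarrow> z" using v_lim by (rule LIMSEQ_offset)
    ultimately show ?case using z(1) Xz by simp
  qed
  ultimately show ?thesis unfolding f_def by blast
qed

end
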